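(* Let $\lambda>0$, $\chi>0$, $R>0$, and let $B_R=\{x\in\mathbb{R}^n:|x|<R\}$. Let $0\le u_0\le a$ be a radially symmetric function in $B_R$, for some constant $0<a<1$, which is monotone decreasing (i.e. nonincreasing) in $r=|x|$ for $0\le r\le R$. Let $T>0$. Suppose $u$ is the unique solution, with $0\le u<1$, in $B_R\times(0,T)$ of $$\frac{\partial u}{\partial t}=\Delta u+\frac{\lambda}{(1-u)^2\bigl(1+\chi\int_{B_R}\frac{dy}{1-u(y,t)}\bigr)^2}\ \text{ in }B_R\times(0,T),\qquad u=0\ \text{ on }\partial B_R\times(0,T),\qquad u(x,0)=u_0\ \text{ in }B_R,$$ and suppose that $u$ touches down at time $T$. Then there exist constants $t_0\in(0,T)$ and $C>0$, depending on $\lambda$ and $\chi$, such that $$1-u(x,t)\ge C|x|^2\quad\text{for all }(x,t)\in B_R\times[t_0,T).$$ Hence $x=0$ is the only quenching point of $u$ at time $T$. Moreover, if $n\ge3$, then $$\sup_{0\le t<T}\int_{B_R}\frac{dz}{1-u(z,t)}<\infty .$$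
   Context: Notion of solution (with $\Omega=B_R$). For $u_0\in L^1(\Omega)$ with $u_0\le a$ a.e. in $\Omega$ for some constant $0<a<1$, a function $u$ is a solution of the problem in $\Omega\times(0,T)$ if $u\in C^{2,1}(\Omega\times(0,T))\cap C(\overline{\Omega}\times(0,T))$, $u<1$, $u$ satisfies the partial differential equation in the classical sense in $\Omega\times(0,T)$, $u(x,t)=0$ on $\partial\Omega\times(0,T)$, $\sup_{\overline{\Omega}\times[0,T']}u<1$ for every $0<T'<T$, and $\|u(\cdot,t)-u_0\|_{L^1(\Omega)}\to0$ as $t\to0$. At $t=0$ one sets $u(\cdot,0)=u_0$. The solution considered is the one provided by a known existence and uniqueness theorem: if $0\le u_0\le a<1$ in $\Omega$, then for some $T>0$ there is a unique solution, it satisfies $0\le u<1$ in $\Omega\times(0,T)$, and $$u(x,t)=\int_{\Omega}G(x,y,t)u_0(y)\,dy+\lambda\int_0^t\int_{\Omega}\frac{G(x,y,t-s)}{(1-u(y,s))^2\bigl(1+\chi\int_{\Omega}\frac{dz}{1-u(z,s)}\bigr)^2}\,dy\,ds$$ for all $(x,t)\in\Omega\times(0,T)$, where $G$ is the Dirichlet Green function for the heat equation in $\Omega\times(0,T)$. Touchdown (quenching) at time $T$ means: $\sup_{\Omega}u(\cdot,t)<1$ for all $0<t<T$ and $\lim_{t\nearrow T}\sup_{\Omega}u(\cdot,t)=1$. A quenching point of $u$ (at time $T$) is a point $x\in\Omega$ for which there is a sequence $(x_k,t_k)\in\Omega\times(0,T)$ with $x_k\to x$ and $u(x_k,t_k)\to1$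 as $k\to\infty$. *)

theory Defs
  imports "HOL-Analysis.Analysis"
begin

definition partially_differentiable :: "'n::finite \<Rightarrow> (real ^ 'n \<Rightarrow> real) \<Rightarrow> real ^ 'n \<Rightarrow> bool" where
  "partially_differentiable i f x \<longleftrightarrow> (\<lambda>s::real. f (x + s *\<^sub>R axis i 1)) differentiable (at 0)"

definition partial :: "'n::finite \<Rightarrow> (real ^ 'n \<Rightarrow> real) \<Rightarrow> real ^ 'n \<Rightarrow> real" where
  "partial i f x = deriv (\<lambda>s::real. f (x + s *\<^sub>R axis i 1)) 0"

definition laplacian :: "(real ^ 'n::finite \<Rightarrow> real) \<Rightarrow> real ^ 'n \<Rightarrow> real" where
  "laplacian f x = (\<Sum>i\<in>UNIV. partial i (partial i f) x)"

definition C21_on :: "(real ^ 'n::finite) set \<Rightarrow> real set \<Rightarrow> (real ^ 'n \<Rightarrow> real \<Rightarrow> real) \<Rightarrow> bool" where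
  "C21_on \<Omega> I u \<longleftrightarrow>
     continuous_on (\<Omega> \<times> I) (\<lambda>(x, t). u x t) \<and>
     (\<forall>x\<in>\<Omega>. \<forall>t\<in>I. u x differentiable (at t)) \<and>
     continuous_on (\<Omega> \<times> I) (\<lambda>(x, t). deriv (u x) t) \<and>
     (\<forall>i. (\<forall>x\<in>\<Omega>. \<forall>t\<in>I. partially_differentiable i (\<lambda>y. u y t) x) \<and>
          continuous_on (\<Omega> \<times> I) (\<lambda>(x, t). partial i (\<lambda>y. u y t) x)) \<and>
     (\<forall>i j. (\<forall>x\<in>\<Omega>. \<forall>t\<in>I. partially_differentiable i (partial j (\<lambda>y. u y t)) x) \<and>
            continuous_on (\<Omega> \<times> I) (\<lambda>(x, t). partial i (partial j (\<lambda>y. u y t)) x))"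

text \<open>
  In \<open>nonlocal_solution\<close> the bound \<open>m < 1\<close> spells out
  \<open>sup u < 1\<close> over \<open>closure \<Omega> \<times> [0, T']\<close>, and the last conjunct is the convergence
  of \<open>u(\<cdot>, t)\<close> to \<open>u0\<close> in \<open>L\<^sup>1(\<Omega>)\<close> (both functions are integrable over \<open>\<Omega>\<close>
  when \<open>\<Omega>\<close> is bounded, so the Bochner integral is the norm).
\<close>

definition nonlocal_solution ::
  "real \<Rightarrow> real \<Rightarrow> (real ^ 'n::finite) set \<Rightarrow> real \<Rightarrow> (real ^ 'n \<Rightarrow> real) \<Rightarrow> (real ^ 'n \<Rightarrow> real \<Rightarrow> real) \<Rightarrow> bool" where
  "nonlocal_solution lam chi \<Omega> T u0 u \<longleftrightarrow>
     set_integrable lebesgue \<Omega> u0 \<and>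
     C21_on \<Omega> {0<..<T} u \<and>
     continuous_on (closure \<Omega> \<times> {0<..<T}) (\<lambda>(x, t). u x t) \<and>
     (\<forall>x\<in>\<Omega>. \<forall>t\<in>{0<..<T}. u x t < 1) \<and>
     (\<forall>x\<in>\<Omega>. \<forall>t\<in>{0<..<T}.
        deriv (u x) t = laplacian (\<lambda>y. u y t) x
          + lam / ((1 - u x t)\<^sup>2 * (1 + chi * (LINT z:\<Omega>|lebesgue. 1 / (1 - u z t)))\<^sup>2)) \<and>
     (\<forall>x\<in>frontier \<Omega>. \<forall>t\<in>{0<..<T}. u x t = 0) \<and>
     (\<forall>x\<in>\<Omega>. u x 0 = u0 x) \<and>
     (\<forall>T'\<in>{0<..<T}. \<exists>m<1. \<forall>x\<in>closure \<Omega>. \<forall>t\<in>{0..T'}. u x t \<le> m) \<and>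
     ((\<lambda>t. LINT x:\<Omega>|lebesgue. \<bar>u x t - u0 x\<bar>) \<longlongrightarrow> 0) (at_right 0)"

definition touches_down_at :: "(real ^ 'n::finite) set \<Rightarrow> real \<Rightarrow> (real ^ 'n \<Rightarrow> real \<Rightarrow> real) \<Rightarrow> bool" where
  "touches_down_at \<Omega> T u \<longleftrightarrow>
     (\<forall>t\<in>{0<..<T}. (SUP x\<in>\<Omega>. u x t) < 1) \<and>
     ((\<lambda>t. SUP x\<in>\<Omega>. u x t) \<longlongrightarrow> 1) (at_left T)"

definition quenching_point ::
  "(real ^ 'n::finite) set \<Rightarrow> real \<Rightarrow> (real ^ 'n \<Rightarrow> real \<Rightarrow> real) \<Rightarrow> real ^ 'n \<Rightarrow> bool" where
  "quenching_point \<Omega> T u x \<longleftrightarrow>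
     x \<in> \<Omega> \<and>
     (\<exists>(X :: nat \<Rightarrow> real ^ 'n) (\<tau> :: nat \<Rightarrow> real).
        (\<forall>k. X k \<in> \<Omega> \<and> \<tau> k \<in> {0<..<T}) \<and>
        X \<longlonglongrightarrow> x \<and> (\<lambda>k. u (X k) (\<tau> k)) \<longlonglongrightarrow> 1)"

end

theory Submission
  imports Defs
begin

text \<open>
  For \<open>x\<^sub>0 \<noteq> 0\<close> put \<open>e = x\<^sub>0 / |x\<^sub>0|\<close> and \<open>h = |x\<^sub>0| / 2\<close>, so that the reflection \<open>m\<close> in the
  hyperplane \<open>x \<bullet> e = h\<close> maps \<open>x\<^sub>0\<close> to the origin. On the cap \<open>x \<bullet> e > h\<close> of the ball the
  difference \<open>w = u - u \<circ> m\<close> satisfies a linear parabolic equation, is nonpositive initially and on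
  the boundary, and hence is nonpositive; as the nonlinearity is increasing, \<open>w\<close> is then a
  subsolution of the heat equation. On the spherical part of the boundary of the cap
  \<open>w = - u \<circ> m\<close>, and \<open>u\<close> stays above \<open>\<epsilon> (R\<^sup>2 - |x|\<^sup>2)\<close> after time \<open>T/2\<close>, where
  \<open>R\<^sup>2 - |m x|\<^sup>2 = 4 h (x \<bullet> e - h)\<close>. So \<open>h\<close> times a caloric function of the single variable
  \<open>s = x \<bullet> e - h\<close>, chosen independently of \<open>x\<^sub>0\<close>, is a barrier for \<open>- w\<close>; evaluated at
  \<open>x\<^sub>0\<close> (where \<open>s = h\<close>) it gives \<open>u(0,t) - u(x\<^sub>0,t) \<ge> C |x\<^sub>0|\<^sup>2\<close> uniformly up to \<open>T\<close>. Near \<open>T\<close> only the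
  positivity of the nonlocal factor is used, so its possible decay to \<open>0\<close> is harmless.
\<close>

subsection \<open>Calculus\<close>

lemma integral_subset_UNIV:
  fixes f :: "'a::euclidean_space \<Rightarrow> 'b::banach"
  assumes "\<And>x. x \<notin> S \<Longrightarrow> f x = 0"
  shows "integral S f = integral UNIV f"
proof -
  have "(\<lambda>x. if x \<in> S then f x else 0) = f" using assms by auto
  then show ?thesis using integral_restrict_UNIV[of S f] by simp
qed

text \<open>By translation invariance the integral of \<open>G (x + s *\<^sub>R d)\<close> is
  constant in \<open>s\<close>, while differentiation under the integral gives the integral of
  \<open>G'\<close> at \<open>s = 0\<close>. This is the integration by parts behind the comparison
  principle.\<close>

lemma integral_directional_derivative_zero:
  fixes G :: "'a::euclidean_space \<Rightarrow> real"
  assumes der: "\<And>x. ((\<lambda>s. G (x + s *\<^sub>R d)) has_real_derivative G' x) (at 0)"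
    and G: "continuous_on UNIV G" and G': "continuous_on UNIV G'"
    and S: "bounded S" "\<And>x. x \<notin> S \<Longrightarrow> G x = 0" "\<And>x. x \<notin> S \<Longrightarrow> G' x = 0"
  shows "integral UNIV G' = 0"
proof -
  obtain B where B: "\<And>x. x \<in> S \<Longrightarrow> norm x \<le> B"
    using S(1) by (auto simp: bounded_iff)
  \<comment> \<open>The margin \<open>norm d\<close> keeps every point outside the box outside
    \<open>S\<close> after a shift by \<open>s *\<^sub>R d\<close> with
    \<open>\<bar>s\<bar> \<le> 1\<close>, so one box serves for all shifts.\<close>
  define M where "M = B + norm d + 1"
  obtain a where a: "cball 0 M \<subseteq> cbox (-a) (a::'a)"
    using bounded_subset_cbox_symmetric[of "cball (0::'a) M"] by auto
  let ?K = "cbox (-a) a"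
  have out: "x + s *\<^sub>R d \<notin> S" if "x \<notin> ?K" "\<bar>s\<bar> \<le> 1" for x s
  proof
    assume "x + s *\<^sub>R d \<in> S"
    then have "norm (x + s *\<^sub>R d) \<le> B" using B by auto
    moreover have "norm x \<le> norm (x + s *\<^sub>R d) + norm (s *\<^sub>R d)"
      by (metis add_diff_cancel_right' norm_triangle_ineq4)
    moreover have "norm (s *\<^sub>R d) \<le> norm d"
      using that(2) by (simp add: mult_left_le_one_le)
    ultimately have "norm x \<le> M" by (simp add: M_def)
    then show False using a that(1) by (auto simp: subset_eq)
  qed
  have const: "integral ?K (\<lambda>x. G (x + s *\<^sub>R d)) = integral UNIV G" if "\<bar>s\<bar> \<le> 1" for s
  proof -
    have "integral ?K (\<lambda>x. G (x + s *\<^sub>R d)) = integral (cbox (- a + s *\<^sub>R d) (a + s *\<^sub>R d)) G"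
      using integral_shift_cbox_plus[of "-a" a G "s *\<^sub>R d"] by (simp add: o_def add.commute)
    also have "\<dots> = integral UNIV G"
    proof (rule integral_subset_UNIV)
      fix x assume "x \<notin> cbox (- a + s *\<^sub>R d) (a + s *\<^sub>R d)"
      then have "x - s *\<^sub>R d \<notin> ?K" by (auto simp: mem_box algebra_simps)
      from out[OF this that] show "G x = 0" using S(2) by simp
    qed
    finally show ?thesis .
  qed
  have der': "((\<lambda>s. G (x + s *\<^sub>R d)) has_real_derivative G' (x + s *\<^sub>R d)) (at s within U)" for x s U
  proof -
    have "((\<lambda>r. G ((x + s *\<^sub>R d) + r *\<^sub>R d)) has_real_derivative G' (x + s *\<^sub>R d)) (at (s - s))"
      using der by simp
    from DERIV_shift[THEN iffD1, OF this[unfolded diff_conv_add_uminus]]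
    have "((\<lambda>r. G ((x + s *\<^sub>R d) + (r - s) *\<^sub>R d)) has_real_derivative G' (x + s *\<^sub>R d)) (at s)"
      by simp
    then show ?thesis
      by (auto simp: algebra_simps intro: has_field_derivative_at_within)
  qed
  have "((\<lambda>s. integral ?K (\<lambda>x. G (x + s *\<^sub>R d))) has_field_derivative
      integral ?K (\<lambda>x. G' (x + 0 *\<^sub>R d))) (at 0 within {-1..1})"
  proof (rule leibniz_rule_field_derivative[OF der'])
    fix s :: real
    show "(\<lambda>x. G (x + s *\<^sub>R d)) integrable_on ?K"
      by (intro integrable_continuous continuous_intros continuous_on_compose2[OF G]) auto
  next
    show "continuous_on ({-1..1} \<times> ?K) (\<lambda>(s, x). G' (x + s *\<^sub>R d))"
      unfolding split_beta
      by (intro continuous_intros continuous_on_compose2[OF G']) auto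
  qed auto
  moreover have "((\<lambda>s. integral ?K (\<lambda>x. G (x + s *\<^sub>R d))) has_field_derivative 0) (at 0 within {-1..1})"
    by (rule has_field_derivative_transform_within[of "\<lambda>_. integral UNIV G" _ _ _ 1])
       (auto simp: const)
  ultimately have "integral ?K G' = 0"
    by (auto simp: at_within_Icc_at intro: DERIV_unique)
  moreover have "integral ?K G' = integral UNIV G'"
    using out[of _ 0] S(3) by (intro integral_subset_UNIV) auto
  ultimately show ?thesis by simp
qed

text \<open>Walk from \<open>x\<close> to \<open>x + v\<close> one coordinate at a time: the mean
  value theorem turns each leg into a partial derivative at a nearby point, and continuity replaces
  that point by \<open>x\<close>.\<close>

lemma has_derivative_from_partials:
  fixes f :: "real ^ 'n::finite \<Rightarrow> real"
  assumes S: "open S" "x \<in> S"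
    and der: "\<And>i y. y \<in> S \<Longrightarrow> ((\<lambda>s. f (y + s *\<^sub>R axis i 1)) has_real_derivative f' i y) (at 0)"
    and cont: "\<And>i. continuous_on S (f' i)"
  shows "(f has_derivative (\<lambda>v. \<Sum>i\<in>UNIV. v $ i * f' i x)) (at x)"
proof -
  have key: "\<exists>\<delta>>0. \<forall>v. norm v < \<delta> \<longrightarrow> \<bar>f (x + v) - f x - (\<Sum>i\<in>UNIV. v $ i * f' i x)\<bar> \<le> e * norm v"
    if "e > 0" for e
  proof -
    define n where "n = real CARD('n)"
    have n: "n > 0" by (simp add: n_def)
    have "\<forall>i. \<exists>\<delta>>0. \<forall>y. dist y x < \<delta> \<longrightarrow> y \<in> S \<and> \<bar>f' i y - f' i x\<bar> \<le> e / n"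
    proof
      fix i
      have "isCont (f' i) x"
        using cont S by (simp add: continuous_on_eq_continuous_at)
      then have "\<forall>\<^sub>F y in nhds x. dist (f' i y) (f' i x) < e / n"
        using that n tendstoD[of "f' i" "f' i x" "nhds x" "e / n"] by (simp add: isCont_def tendsto_at_iff_tendsto_nhds)
      moreover have "\<forall>\<^sub>F y in nhds x. y \<in> S"
        using S by (simp add: eventually_nhds_in_open)
      ultimately have "\<forall>\<^sub>F y in nhds x. y \<in> S \<and> \<bar>f' i y - f' i x\<bar> \<le> e / n"
        by eventually_elim (simp add: dist_real_def)
      then show "\<exists>\<delta>>0. \<forall>y. dist y x < \<delta> \<longrightarrow> y \<in> S \<and> \<bar>f' i y - f' i x\<bar> \<le> e / n"
        by (simp add: eventually_nhds_metric)
    qed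
    then obtain D where D: "\<And>i. D i > 0"
      "\<And>i y. dist y x < D i \<Longrightarrow> y \<in> S \<and> \<bar>f' i y - f' i x\<bar> \<le> e / n" by metis
    define \<delta> where "\<delta> = Min (range D)"
    have \<delta>: "\<delta> > 0" "\<And>i y. dist y x < \<delta> \<Longrightarrow> y \<in> S \<and> \<bar>f' i y - f' i x\<bar> \<le> e / n"
      using D by (auto simp: \<delta>_def)
    have "\<bar>f (x + v) - f x - (\<Sum>i\<in>UNIV. v $ i * f' i x)\<bar> \<le> e * norm v" if v: "norm v < \<delta>" for v
    proof -
      \<comment> \<open>\<open>r A\<close> keeps the coordinates of \<open>v\<close> in
        \<open>A\<close>, so the induction on \<open>A\<close> adds one leg at a time. Each leg may
        err by \<open>e / n\<close> times its length, and all its points stay within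
        \<open>norm v\<close> of \<open>x\<close>.\<close>
      define r where "r A = (\<chi> i. if i \<in> A then v $ i else 0)" for A
      have norm_r: "norm (r A + s *\<^sub>R axis i 1) \<le> norm v" if "i \<notin> A" "\<bar>s\<bar> \<le> \<bar>v $ i\<bar>" for A i s
        using that by (intro norm_le_componentwise_cart) (auto simp: r_def axis_def)
      have "\<bar>f (x + r A) - f x - (\<Sum>i\<in>A. v $ i * f' i x)\<bar> \<le> (\<Sum>i\<in>A. e / n * \<bar>v $ i\<bar>)" for A
      proof (induction A rule: infinite_finite_induct)
        case (insert i A)
        let ?y = "\<lambda>s. x + r A + s *\<^sub>R axis i 1"
        have r_ins: "r (insert i A) = r A + (v $ i) *\<^sub>R axis i 1"
          using insert by (auto simp: r_def vec_eq_iff axis_def)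
        have near: "dist (?y s) x < \<delta>" if "\<bar>s\<bar> \<le> \<bar>v $ i\<bar>" for s
          using norm_r[OF insert(2) that] v by (simp add: dist_norm add.assoc)
        have d: "((\<lambda>s. f (?y s)) has_real_derivative f' i (?y s)) (at s)" if "\<bar>s\<bar> \<le> \<bar>v $ i\<bar>" for s
        proof -
          have "((\<lambda>q. f (?y s + q *\<^sub>R axis i 1)) has_real_derivative f' i (?y s)) (at (s + - s))"
            using der \<delta>(2)[OF near[OF that]] by simp
          from DERIV_shift[THEN iffD1, OF this]
          show ?thesis by (simp add: algebra_simps)
        qed
        have "\<exists>s. \<bar>s\<bar> \<le> \<bar>v $ i\<bar> \<and> f (?y (v $ i)) - f (?y 0) = v $ i * f' i (?y s)"
        proof (cases "v $ i" "0::real" rule: linorder_cases)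
          case less
          have "\<exists>z>v $ i. z < 0 \<and> f (?y 0) - f (?y (v $ i)) = (0 - v $ i) * f' i (?y z)"
            by (rule MVT2[OF less]) (use less in \<open>auto intro!: d\<close>)
          then obtain z where "v $ i < z" "z < 0" "f (?y 0) - f (?y (v $ i)) = (0 - v $ i) * f' i (?y z)"
            by blast
          then show ?thesis by (intro exI[of _ z]) (simp add: algebra_simps)
        next
          case greater
          have "\<exists>z>0. z < v $ i \<and> f (?y (v $ i)) - f (?y 0) = (v $ i - 0) * f' i (?y z)"
            by (rule MVT2[OF greater]) (use greater in \<open>auto intro!: d\<close>)
          then obtain z where "0 < z" "z < v $ i" "f (?y (v $ i)) - f (?y 0) = (v $ i - 0) * f' i (?y z)"
            by blast
          then show ?thesis by (intro exI[of _ z]) simp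
        qed auto
        then obtain s where s: "\<bar>s\<bar> \<le> \<bar>v $ i\<bar>" "f (?y (v $ i)) - f (?y 0) = v $ i * f' i (?y s)"
          by blast
        have "\<bar>v $ i * f' i (?y s) - v $ i * f' i x\<bar> \<le> e / n * \<bar>v $ i\<bar>"
          using mult_left_mono[of "\<bar>f' i (?y s) - f' i x\<bar>" "e / n" "\<bar>v $ i\<bar>"] \<delta>(2)[OF near[OF s(1)], of i]
          by (simp add: right_diff_distrib[symmetric] abs_mult mult.commute)
        with insert s r_ins show ?case
          by (simp add: add.assoc[symmetric])
      qed (auto simp: r_def zero_vec_def[symmetric])
      from this[of UNIV] have "\<bar>f (x + v) - f x - (\<Sum>i\<in>UNIV. v $ i * f' i x)\<bar> \<le> (\<Sum>i\<in>UNIV. e / n * \<bar>v $ i\<bar>)"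
        by (simp add: r_def)
      also have "\<dots> \<le> (\<Sum>i\<in>(UNIV::'n set). e / n * norm v)"
        using \<open>e > 0\<close> n by (intro sum_mono mult_left_mono component_le_norm_cart) auto
      also have "\<dots> = e * norm v" using n by (simp add: n_def)
      finally show ?thesis .
    qed
    then show ?thesis using \<delta>(1) by blast
  qed
  show ?thesis
    unfolding has_derivative_at_alt
  proof (intro conjI allI impI)
    show "bounded_linear (\<lambda>v. \<Sum>i\<in>UNIV. v $ i * f' i x)"
      by (intro bounded_linear_intros bounded_linear_sum) auto
    fix e :: real assume "e > 0"
    from key[OF this] obtain \<delta> where \<delta>: "\<delta> > 0"
      "\<And>v. norm v < \<delta> \<Longrightarrow> \<bar>f (x + v) - f x - (\<Sum>i\<in>UNIV. v $ i * f' i x)\<bar> \<le> e * norm v" by blast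
    show "\<exists>d>0. \<forall>y. norm (y - x) < d \<longrightarrow>
        norm (f y - f x - (\<Sum>i\<in>UNIV. (y - x) $ i * f' i x)) \<le> e * norm (y - x)"
    proof (intro exI[of _ \<delta>] conjI allI impI)
      fix y assume "norm (y - x) < \<delta>"
      from \<delta>(2)[OF this]
      show "norm (f y - f x - (\<Sum>i\<in>UNIV. (y - x) $ i * f' i x)) \<le> e * norm (y - x)"
        by simp
    qed (rule \<delta>(1))
  qed
qed

subsection \<open>A comparison principle for the heat operator\<close>

text \<open>\<open>wt\<close>, \<open>w1 i\<close> and \<open>w2 i\<close> are the time derivative and the first and second pure partial
  derivatives; mixed ones play no role in the heat operator.\<close>

definition heat_regular ::
  "(real ^ 'n::finite) set \<Rightarrow> real set \<Rightarrow> (real ^ 'n \<Rightarrow> real \<Rightarrow> real) \<Rightarrow> (real ^ 'n \<Rightarrow> real \<Rightarrow> real)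
    \<Rightarrow> ('n \<Rightarrow> real ^ 'n \<Rightarrow> real \<Rightarrow> real) \<Rightarrow> ('n \<Rightarrow> real ^ 'n \<Rightarrow> real \<Rightarrow> real) \<Rightarrow> bool" where
  "heat_regular D J w wt w1 w2 \<longleftrightarrow>
     (\<forall>x\<in>D. \<forall>t\<in>J. (w x has_real_derivative wt x t) (at t) \<and>
        (\<forall>i. ((\<lambda>s. w (x + s *\<^sub>R axis i 1) t) has_real_derivative w1 i x t) (at 0) \<and>
             ((\<lambda>s. w1 i (x + s *\<^sub>R axis i 1) t) has_real_derivative w2 i x t) (at 0))) \<and>
     continuous_on (D \<times> J) (\<lambda>(x, t). w x t) \<and> continuous_on (D \<times> J) (\<lambda>(x, t). wt x t) \<and>
     (\<forall>i. continuous_on (D \<times> J) (\<lambda>(x, t). w1 i x t) \<and> continuous_on (D \<times> J) (\<lambda>(x, t). w2 i x t))"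

lemma heat_regular_mono:
  assumes "heat_regular D J w wt w1 w2" "D' \<subseteq> D" "J' \<subseteq> J"
  shows "heat_regular D' J' w wt w1 w2"
proof -
  have "D' \<times> J' \<subseteq> D \<times> J" using assms by auto
  then show ?thesis
    using assms unfolding heat_regular_def by (blast intro: continuous_on_subset)
qed

lemma heat_regular_add:
  assumes "heat_regular D J w wt w1 w2" "heat_regular D J v vt v1 v2"
  shows "heat_regular D J (\<lambda>x t. w x t + v x t) (\<lambda>x t. wt x t + vt x t)
    (\<lambda>i x t. w1 i x t + v1 i x t) (\<lambda>i x t. w2 i x t + v2 i x t)"
  using assms unfolding heat_regular_def split_beta
  by (intro conjI ballI allI DERIV_add continuous_on_add) auto

lemma heat_regular_time_mult:
  assumes w: "heat_regular D J w wt w1 w2"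
    and \<theta>: "\<And>t. t \<in> J \<Longrightarrow> (\<theta> has_real_derivative \<theta>' t) (at t)" "continuous_on J \<theta>'"
  shows "heat_regular D J (\<lambda>x t. \<theta> t * w x t) (\<lambda>x t. \<theta>' t * w x t + \<theta> t * wt x t)
    (\<lambda>i x t. \<theta> t * w1 i x t) (\<lambda>i x t. \<theta> t * w2 i x t)"
proof -
  have "continuous_on J \<theta>"
    using \<theta>(1) by (meson DERIV_atLeastAtMost_imp_continuous_on DERIV_isCont continuous_at_imp_continuous_on)
  then have c: "continuous_on (D \<times> J) (\<lambda>p. \<theta> (snd p))" "continuous_on (D \<times> J) (\<lambda>p. \<theta>' (snd p))"
    using \<theta>(2) by (auto intro!: continuous_on_compose2[of J _ "D \<times> J" snd] continuous_intros)
  show ?thesis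
    using w \<theta>(1) c unfolding heat_regular_def split_beta
    by (intro conjI ballI allI continuous_intros) (auto intro!: derivative_eq_intros)
qed

lemma heat_regular_static:
  assumes "\<And>i x. x \<in> D \<Longrightarrow> ((\<lambda>s. q (x + s *\<^sub>R axis i 1)) has_real_derivative q1 i x) (at 0)"
    and "\<And>i x. x \<in> D \<Longrightarrow> ((\<lambda>s. q1 i (x + s *\<^sub>R axis i 1)) has_real_derivative q2 i x) (at 0)"
    and "continuous_on D q" "\<And>i. continuous_on D (q1 i)" "\<And>i. continuous_on D (q2 i)"
  shows "heat_regular D J (\<lambda>x t. q x) (\<lambda>x t. 0) (\<lambda>i x t. q1 i x) (\<lambda>i x t. q2 i x)"
proof -
  have *: "continuous_on (D \<times> J) (\<lambda>p. h (fst p))" if "continuous_on D h" for h :: "real ^ 'a \<Rightarrow> real"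
    by (rule continuous_on_compose2[OF that]) (auto intro!: continuous_intros)
  show ?thesis
    unfolding heat_regular_def split_beta using assms by (auto intro!: * continuous_intros)
qed

text \<open>Only the kink \<open>y = 0\<close> is delicate: the difference quotient there is at most
  \<open>\<bar>h\<bar> ^ (n - 1)\<close>, which tends to 0 because \<open>n \<ge> 2\<close>.
  Exponents 3 and 2 serve for the cube of a truncated function and for its gradient.\<close>

lemma has_real_derivative_max_power:
  assumes "n \<ge> 2"
  shows "((\<lambda>y::real. max 0 y ^ n) has_real_derivative real n * max 0 y ^ (n - 1)) (at y)"
proof -
  have n: "n > 0" "n - 1 > 0" using assms by auto
  then have z: "(0::real) ^ (n - 1) = 0" by (simp only: zero_power)
  consider "y > 0" | "y < 0" | "y = 0" by linarith
  then show ?thesis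
  proof cases
    case 1
    have "((\<lambda>y::real. y ^ n) has_real_derivative real n * max 0 y ^ (n - 1)) (at y)"
      using 1 by (auto intro!: derivative_eq_intros)
    then show ?thesis
      by (rule has_field_derivative_transform_within_open[of _ _ _ "{0<..}"]) (use 1 in auto)
  next
    case 2
    have "((\<lambda>y::real. 0) has_real_derivative real n * max 0 y ^ (n - 1)) (at y)"
      using 2 by (simp only: max_absorb1 less_imp_le z mult_zero_right DERIV_const)
    then show ?thesis
      by (rule has_field_derivative_transform_within_open[of _ _ _ "{..<0}"]) (use 2 n in auto)
  next
    case 3
    have "((\<lambda>h. max 0 h ^ n / h) \<longlongrightarrow> 0) (at (0::real))"
    proof (rule Lim_null_comparison)
      show "((\<lambda>h::real. \<bar>h\<bar> ^ (n - 1)) \<longlongrightarrow> 0) (at 0)"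
        using n by (auto intro!: tendsto_eq_intros simp: zero_power)
      have "norm (max 0 h ^ n / h) \<le> \<bar>h\<bar> ^ (n - 1)" for h :: real
      proof -
        have "\<bar>max 0 h ^ n / h\<bar> \<le> \<bar>h\<bar> ^ n / \<bar>h\<bar>"
          by (auto simp: power_abs intro!: divide_right_mono power_mono)
        also have "\<dots> \<le> \<bar>h\<bar> ^ (n - 1)"
          using n(1) by (cases n) auto
        finally show ?thesis by simp
      qed
      then show "\<forall>\<^sub>F h in at (0::real). norm (max 0 h ^ n / h) \<le> \<bar>h\<bar> ^ (n - 1)" by simp
    qed
    then show ?thesis using 3 n by (simp add: DERIV_def power_0_left)
  qed
qed

text \<open>The set \<open>v \<ge> \<epsilon>\<close> is relatively closed and misses the lateral
  boundary, so \<open>D \<times> J\<close> and the complement of that set form an open cover of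
  \<open>UNIV \<times> J\<close>; the extension is \<open>g\<close> on the first and 0 on the
  second.\<close>

lemma continuous_on_zero_extension:
  fixes v g :: "'a::euclidean_space \<times> real \<Rightarrow> real"
  assumes D: "open D" and J: "open J" and \<epsilon>: "\<epsilon> > 0"
    and v: "continuous_on (closure D \<times> J) v"
    and bdry: "\<And>p. p \<in> (closure D - D) \<times> J \<Longrightarrow> v p < \<epsilon>"
    and g: "continuous_on (D \<times> J) g"
    and zero: "\<And>p. p \<in> D \<times> J \<Longrightarrow> v p < \<epsilon> \<Longrightarrow> g p = 0"
  shows "continuous_on (UNIV \<times> J) (\<lambda>p. if fst p \<in> D then g p else 0)"
    and "\<And>x t. x \<notin> D \<Longrightarrow> t \<in> J \<Longrightarrow> \<forall>\<^sub>F y in nhds x. y \<in> D \<longrightarrow> v (y, t) < \<epsilon>"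
proof -
  define U where "U = {p \<in> closure D \<times> J. v p \<ge> \<epsilon>}"
  have "closedin (top_of_set (closure D \<times> J)) U"
    unfolding U_def using continuous_closedin_preimage[OF v closed_atLeast[of \<epsilon>]]
    by (simp add: vimage_def Int_def conj_commute)
  then obtain C where C: "closed C" "U = closure D \<times> J \<inter> C"
    by (auto simp: closedin_closed)
  have UC: "U = (UNIV \<times> J) \<inter> ((closure D \<times> UNIV) \<inter> C)" using C by auto
  define V where "V = (UNIV \<times> J) - ((closure D \<times> UNIV) \<inter> C)"
  have openV: "open V" unfolding V_def
    by (intro open_Diff open_Times closed_Int closed_Times C J) auto
  have V: "V = (UNIV \<times> J) - U" unfolding V_def UC by auto
  have cover: "UNIV \<times> J = D \<times> J \<union> V"
    using bdry by (force simp: V U_def)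
  have zeroV: "(if fst p \<in> D then g p else 0) = 0" if "p \<in> V" for p
    using that zero[of p] closure_subset[of D] by (cases p) (force simp: V U_def)
  have "continuous_on (D \<times> J \<union> V) (\<lambda>p. if fst p \<in> D then g p else 0)"
  proof (rule continuous_on_open_Un)
    show "open (D \<times> J)" using D J by (rule open_Times)
    show "continuous_on (D \<times> J) (\<lambda>p. if fst p \<in> D then g p else 0)"
      by (rule continuous_on_eq[OF g]) auto
    show "continuous_on V (\<lambda>p. if fst p \<in> D then g p else 0)"
      by (rule continuous_on_eq[of _ "\<lambda>_. 0"]) (use zeroV in auto)
  qed (rule openV)
  then show "continuous_on (UNIV \<times> J) (\<lambda>p. if fst p \<in> D then g p else 0)"
    by (simp add: cover)
  fix x t assume "x \<notin> D" "t \<in> J"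
  then have "(x, t) \<in> V" using cover by auto
  then have "\<forall>\<^sub>F p in nhds (x, t). p \<in> V" using openV by (simp add: eventually_nhds_in_open)
  moreover have "((\<lambda>y. (y, t)) \<longlongrightarrow> (x, t)) (nhds x)"
    by (intro tendsto_intros) (auto simp: filterlim_def)
  ultimately have "\<forall>\<^sub>F y in nhds x. (y, t) \<in> V"
    by (auto simp: filterlim_iff)
  then show "\<forall>\<^sub>F y in nhds x. y \<in> D \<longrightarrow> v (y, t) < \<epsilon>"
    by eventually_elim (use closure_subset[of D] in \<open>force simp: V U_def\<close>)
qed

text \<open>The integral of the cube of \<open>(v - \<epsilon>)\<^sup>+\<close> decreases in time: the cube is \<open>C\<^sup>2\<close>, the cut-off
  \<open>\<epsilon>\<close> makes the support compact in \<open>D\<close>, so the integration by parts has no boundary terms.\<close>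

lemma heat_comparison_ae:
  fixes v :: "real ^ 'n::finite \<Rightarrow> real \<Rightarrow> real"
  assumes D: "open D" "bounded D"
    and reg: "heat_regular D {s<..<T} v vt v1 v2"
    and cont: "continuous_on (closure D \<times> {s<..<T}) (\<lambda>(x, t). v x t)"
    and bdry: "\<And>x t. x \<in> closure D - D \<Longrightarrow> t \<in> {s<..<T} \<Longrightarrow> v x t \<le> 0"
    and sub: "\<And>x t. x \<in> D \<Longrightarrow> t \<in> {s<..<T} \<Longrightarrow> v x t > 0 \<Longrightarrow> vt x t \<le> (\<Sum>i\<in>UNIV. v2 i x t)"
    and bound: "\<And>x t. x \<in> D \<Longrightarrow> t \<in> {s<..<T} \<Longrightarrow> v x t \<le> B"
    and \<tau>: "\<And>k. \<tau> k \<in> {s<..<T}" "\<tau> \<longlonglongrightarrow> s"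
    and N: "negligible N"
    and init: "\<And>x e. x \<in> D - N \<Longrightarrow> e > 0 \<Longrightarrow> \<forall>\<^sub>F k in sequentially. v x (\<tau> k) < e"
    and x: "x0 \<in> D" "t0 \<in> {s<..<T}"
  shows "v x0 t0 \<le> 0"
proof (rule field_le_epsilon)
  fix \<epsilon> :: real assume \<epsilon>: "\<epsilon> > 0"
  let ?J = "{s<..<T}"
  obtain a where a: "D \<subseteq> box (-a) a"
    using bounded_subset_box_symmetric[OF D(2)] by blast
  let ?K = "cbox (-a) a"
  have DK: "D \<subseteq> ?K" using a box_subset_cbox by blast
  define m where "m x t = max 0 (v x t - \<epsilon>)" for x t
  define F where "F x t = (if x \<in> D then m x t ^ 3 else 0)" for x t
  define Ft where "Ft x t = (if x \<in> D then 3 * m x t ^ 2 * vt x t else 0)" for x t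
  define G where "G i x t = (if x \<in> D then 3 * m x t ^ 2 * v1 i x t else 0)" for i x t
  \<comment> \<open>The derivative of \<open>G i\<close> in direction \<open>i\<close>. Besides the
    second-derivative term it contains \<open>6 * m x t * (v1 i x t)\<^sup>2\<close>, whose sign
    makes the integral of \<open>F\<close> decrease.\<close>
  define G' where "G' i x t = (if x \<in> D then 6 * m x t * (v1 i x t)\<^sup>2 + 3 * m x t ^ 2 * v2 i x t else 0)" for i x t
  note regD = reg[unfolded heat_regular_def]
  have cv: "continuous_on (D \<times> ?J) (\<lambda>p. v (fst p) (snd p))"
    and cvt: "continuous_on (D \<times> ?J) (\<lambda>p. vt (fst p) (snd p))"
    and cv1: "continuous_on (D \<times> ?J) (\<lambda>p. v1 i (fst p) (snd p))"
    and cv2: "continuous_on (D \<times> ?J) (\<lambda>p. v2 i (fst p) (snd p))" for i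
    using regD by (auto simp: split_beta)
  have cm: "continuous_on (D \<times> ?J) (\<lambda>p. m (fst p) (snd p))"
    unfolding m_def by (intro continuous_intros cv)
  have cont': "continuous_on (closure D \<times> ?J) (\<lambda>p. v (fst p) (snd p))"
    using cont by (simp add: split_beta)
  have small: "m x t = 0" if "v x t < \<epsilon>" for x t
    using that by (simp add: m_def)
  have bdry_less: "v (fst p) (snd p) < \<epsilon>" if "p \<in> (closure D - D) \<times> ?J" for p
    using bdry[of "fst p" "snd p"] that \<epsilon> by auto
  have ext: "continuous_on (UNIV \<times> ?J) (\<lambda>p. if fst p \<in> D then g p else 0)"
    if "continuous_on (D \<times> ?J) g" "\<And>p. m (fst p) (snd p) = 0 \<Longrightarrow> g p = 0" for g :: "(real ^ 'n) \<times> real \<Rightarrow> real"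
    by (rule continuous_on_zero_extension(1)[where v = "\<lambda>p. v (fst p) (snd p)" and \<epsilon> = \<epsilon>])
       (use D(1) cont' that \<epsilon> bdry_less small in auto)
  have near: "\<forall>\<^sub>F y in nhds x. y \<in> D \<longrightarrow> m y t = 0" if "x \<notin> D" "t \<in> ?J" for x t
  proof -
    have "\<forall>\<^sub>F y in nhds x. y \<in> D \<longrightarrow> v (fst (y, t)) (snd (y, t)) < \<epsilon>"
      by (rule continuous_on_zero_extension(2)[where v = "\<lambda>p. v (fst p) (snd p)" and \<epsilon> = \<epsilon> and g = "\<lambda>_. 0"])
         (use D(1) cont' that \<epsilon> bdry_less in auto)
    then show ?thesis by eventually_elim (auto intro!: small)
  qed
  have cF: "continuous_on (UNIV \<times> ?J) (\<lambda>p. F (fst p) (snd p))"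
    unfolding F_def by (rule ext) (auto intro!: continuous_intros cm)
  have cFt: "continuous_on (UNIV \<times> ?J) (\<lambda>p. Ft (fst p) (snd p))"
    unfolding Ft_def by (rule ext) (auto intro!: continuous_intros cm cvt)
  have cG: "continuous_on (UNIV \<times> ?J) (\<lambda>p. G i (fst p) (snd p))" for i
    unfolding G_def by (rule ext) (auto intro!: continuous_intros cm cv1)
  have cG': "continuous_on (UNIV \<times> ?J) (\<lambda>p. G' i (fst p) (snd p))" for i
    unfolding G'_def by (rule ext) (auto intro!: continuous_intros cm cv1 cv2)
  have slice: "continuous_on S (\<lambda>x. H x t)"
    if "continuous_on (UNIV \<times> ?J) (\<lambda>p. H (fst p) (snd p))" "t \<in> ?J" for S t and H :: "real ^ 'n \<Rightarrow> real \<Rightarrow> real"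
    by (rule continuous_on_compose2[OF that(1), of S "\<lambda>x. (x, t)", simplified]) (use that in \<open>auto intro!: continuous_intros\<close>)
  have outside: "integral ?K (\<lambda>x. H x) = integral UNIV H" if "\<And>x. x \<notin> D \<Longrightarrow> H x = 0" for H :: "real ^ 'n \<Rightarrow> real"
    by (rule integral_subset_UNIV) (use that DK in blast)
  define I where "I t = integral ?K (\<lambda>x. F x t)" for t
  have G'0: "integral ?K (\<lambda>x. G' i x t) = 0" if t: "t \<in> ?J" for i t
  proof -
    have "integral UNIV (\<lambda>x. G' i x t) = 0"
    proof (rule integral_directional_derivative_zero[where S = D and d = "axis i 1"])
      fix x :: "real ^ 'n"
      have "isCont (\<lambda>s::real. x + s *\<^sub>R axis i 1) 0"
        by (intro continuous_intros)
      then have lim: "((\<lambda>s. x + s *\<^sub>R axis i 1) \<longlongrightarrow> x) (nhds (0::real))"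
        using tendsto_at_iff_tendsto_nhds[of "\<lambda>s::real. x + s *\<^sub>R axis i 1" 0] by (simp add: isCont_def)
      show "((\<lambda>s. G i (x + s *\<^sub>R axis i 1) t) has_real_derivative G' i x t) (at 0)"
      proof (cases "x \<in> D")
        case True
        let ?y = "\<lambda>s. x + s *\<^sub>R axis i 1"
        have dv: "((\<lambda>s. v (?y s) t - \<epsilon>) has_real_derivative v1 i x t) (at 0)"
          and dv1: "((\<lambda>s. v1 i (?y s) t) has_real_derivative v2 i x t) (at 0)"
          using regD True t by (auto intro!: derivative_eq_intros)
        have "((\<lambda>s. m (?y s) t ^ 2) has_real_derivative 2 * m x t * v1 i x t) (at 0)"
          using DERIV_chain2[OF has_real_derivative_max_power dv, of 2] by (simp add: m_def)
        from DERIV_cmult[OF DERIV_mult[OF this dv1], of 3]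
        have d: "((\<lambda>s. 3 * m (?y s) t ^ 2 * v1 i (?y s) t) has_real_derivative G' i x t) (at 0)"
          using True by (simp add: G'_def algebra_simps power2_eq_square)
        have "\<forall>\<^sub>F s in nhds 0. ?y s \<in> D"
          using lim eventually_nhds_in_open[OF D(1) True] by (auto simp: filterlim_iff)
        then have "\<forall>\<^sub>F s in nhds 0. G i (?y s) t = 3 * m (?y s) t ^ 2 * v1 i (?y s) t"
          by eventually_elim (simp add: G_def)
        with d show ?thesis by (subst DERIV_cong_ev[OF refl _ refl])
      next
        case False
        have "\<forall>\<^sub>F s in nhds 0. x + s *\<^sub>R axis i 1 \<in> D \<longrightarrow> m (x + s *\<^sub>R axis i 1) t = 0"
          using lim near[OF False t] by (auto simp: filterlim_iff)
        then have "\<forall>\<^sub>F s in nhds 0. G i (x + s *\<^sub>R axis i 1) t = 0"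
          by eventually_elim (auto simp: G_def)
        then have "((\<lambda>s. G i (x + s *\<^sub>R axis i 1) t) has_real_derivative 0) (at 0)"
          by (subst DERIV_cong_ev[OF refl _ refl]) auto
        with False show ?thesis by (simp add: G'_def)
      qed
    qed (use D(2) slice[OF cG t] slice[OF cG' t] in \<open>auto simp: G_def G'_def\<close>)
    then show ?thesis by (subst outside) (auto simp: G'_def)
  qed
  have dI: "(I has_real_derivative integral ?K (\<lambda>x. Ft x t)) (at t)" if t: "t \<in> ?J" for t
  proof -
    have "(I has_field_derivative integral ?K (\<lambda>x. Ft x t)) (at t within ?J)"
      unfolding I_def
    proof (rule leibniz_rule_field_derivative)
      fix r x assume r: "r \<in> ?J" "x \<in> ?K"
      show "((\<lambda>r. F x r) has_field_derivative Ft x r) (at r within ?J)"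
      proof (cases "x \<in> D")
        case True
        then have "((\<lambda>r. v x r - \<epsilon>) has_real_derivative vt x r) (at r)"
          using regD r by (auto intro!: derivative_eq_intros)
        from DERIV_chain2[OF has_real_derivative_max_power this, of 3]
        show ?thesis using True
          by (auto simp: F_def Ft_def m_def intro: has_field_derivative_at_within)
      qed (simp add: F_def Ft_def)
    next
      show "(\<lambda>x. F x r) integrable_on ?K" if "r \<in> ?J" for r
        using slice[OF cF that] by (rule integrable_continuous)
      show "continuous_on (?J \<times> ?K) (\<lambda>(r, x). Ft x r)"
        unfolding split_beta
        by (rule continuous_on_compose2[OF cFt, of _ "\<lambda>p. (snd p, fst p)", simplified])
           (auto intro!: continuous_intros)
    qed (use t in auto)
    then show ?thesis unfolding at_within_open[OF t open_greaterThanLessThan] .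
  qed
  have I'_le: "integral ?K (\<lambda>x. Ft x t) \<le> 0" if t: "t \<in> ?J" for t
  proof -
    have "integral ?K (\<lambda>x. Ft x t) \<le> integral ?K (\<lambda>x. \<Sum>i\<in>UNIV. G' i x t)"
    proof (rule integral_le)
      fix x
      \<comment> \<open>Where \<open>m\<close> vanishes both sides are 0; elsewhere
        \<open>v > \<epsilon>\<close>, so the differential inequality \<open>sub\<close> is
        available.\<close>
      have "3 * m x t ^ 2 * vt x t \<le> 3 * m x t ^ 2 * (\<Sum>i\<in>UNIV. v2 i x t)" if "x \<in> D"
        using sub[OF that t] \<epsilon> by (cases "m x t = 0") (auto simp: m_def intro!: mult_left_mono split: if_splits)
      also have "\<dots> \<le> (\<Sum>i\<in>UNIV. 6 * m x t * (v1 i x t)\<^sup>2 + 3 * m x t ^ 2 * v2 i x t)"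
        unfolding sum_distrib_left by (intro sum_mono) (simp add: m_def)
      finally show "Ft x t \<le> (\<Sum>i\<in>UNIV. G' i x t)"
        by (simp add: Ft_def G'_def)
    qed (auto intro!: integrable_continuous slice[OF cFt t] slice[OF cG' t] continuous_on_sum)
    also have "\<dots> = (\<Sum>i\<in>UNIV. integral ?K (\<lambda>x. G' i x t))"
      by (rule integral_sum) (auto intro!: integrable_continuous slice[OF cG' t])
    finally show ?thesis by (simp add: G'0[OF t])
  qed
  have mono: "I r \<le> I q" if "q \<le> r" "q \<in> ?J" "r \<in> ?J" for q r
  proof (rule DERIV_nonpos_imp_nonincreasing[OF that(1)])
    fix t assume "q \<le> t" "t \<le> r"
    then have "t \<in> ?J" using that by auto
    then show "\<exists>y. (I has_real_derivative y) (at t) \<and> y \<le> 0"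
      using dI I'_le by blast
  qed
  \<comment> \<open>Initial values enter through dominated convergence, with a constant on the
    bounded box as majorant; off \<open>N\<close> the integrand is eventually 0.\<close>
  have "(\<lambda>k. integral ?K (\<lambda>x. if x \<in> N then 0 else F x (\<tau> k))) \<longlonglongrightarrow> integral ?K (\<lambda>x. 0)"
  proof (rule dominated_convergence)
    fix k
    have "(\<lambda>x. F x (\<tau> k)) integrable_on ?K"
      using slice[OF cF \<tau>(1)] by (rule integrable_continuous)
    then show "(\<lambda>x. if x \<in> N then 0 else F x (\<tau> k)) integrable_on ?K"
      by (rule integrable_spike[OF _ N]) auto
    show "(\<lambda>x. max 0 (B - \<epsilon>) ^ 3) integrable_on ?K" by auto
    fix x
    show "norm (if x \<in> N then 0 else F x (\<tau> k)) \<le> max 0 (B - \<epsilon>) ^ 3"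
      using bound[OF _ \<tau>(1), of x k] by (auto simp: F_def m_def intro!: power_mono)
  next
    fix x
    show "(\<lambda>k. if x \<in> N then 0 else F x (\<tau> k)) \<longlonglongrightarrow> 0"
    proof (cases "x \<in> D - N")
      case True
      from init[OF this \<epsilon>] have "\<forall>\<^sub>F k in sequentially. (if x \<in> N then 0 else F x (\<tau> k)) = 0"
        by eventually_elim (auto simp: F_def m_def)
      then show ?thesis by (rule tendsto_eventually)
    next
      case False
      then have "(if x \<in> N then 0 else F x (\<tau> k)) = 0" for k by (auto simp: F_def)
      then show ?thesis by simp
    qed
  qed
  moreover have "integral ?K (\<lambda>x. if x \<in> N then 0 else F x (\<tau> k)) = I (\<tau> k)" for k
    unfolding I_def by (rule integral_spike[OF N]) auto
  ultimately have "(\<lambda>k. I (\<tau> k)) \<longlonglongrightarrow> 0" by simp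
  moreover have "\<forall>\<^sub>F k in sequentially. I t0 \<le> I (\<tau> k)"
    using order_tendstoD(2)[OF \<tau>(2), of t0] x(2) \<tau>(1) by (auto elim!: eventually_mono intro!: mono)
  ultimately have "I t0 \<le> 0"
    by (intro tendsto_lowerbound[of "\<lambda>k. I (\<tau> k)" 0 sequentially]) auto
  moreover have Fnn: "F x t0 \<ge> 0" for x by (simp add: F_def m_def)
  then have "I t0 \<ge> 0" unfolding I_def
    by (intro integral_nonneg integrable_continuous slice[OF cF x(2)]) auto
  ultimately have "I t0 = 0" by simp
  then have "((\<lambda>x. F x t0) has_integral 0) ?K"
    using integrable_integral[OF integrable_continuous[OF slice[OF cF x(2)]]] by (metis I_def)
  \<comment> \<open>A continuous nonnegative function with integral 0 over the box vanishes
    throughout it.\<close>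
  then have "F x0 t0 = 0"
    by (rule has_integral_0_cbox_imp_0[OF slice[OF cF x(2)] Fnn]) (use a x DK in auto)
  then show "v x0 t0 \<le> 0 + \<epsilon>" using x by (simp add: F_def m_def)
qed

text \<open>The variant for functions continuous up to the initial time. The final time is lowered
  to some \<open>r\<close> with \<open>t0 < r < T\<close>, so that compactness supplies the bound
  \<open>B\<close> even if \<open>v\<close> is unbounded near \<open>T\<close>.\<close>

lemma heat_comparison:
  fixes v :: "real ^ 'n::finite \<Rightarrow> real \<Rightarrow> real"
  assumes D: "open D" "bounded D"
    and reg: "heat_regular D {s<..<T} v vt v1 v2"
    and cont: "continuous_on (closure D \<times> {s..<T}) (\<lambda>(x, t). v x t)"
    and bdry: "\<And>x t. x \<in> closure D - D \<Longrightarrow> t \<in> {s<..<T} \<Longrightarrow> v x t \<le> 0"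
    and sub: "\<And>x t. x \<in> D \<Longrightarrow> t \<in> {s<..<T} \<Longrightarrow> v x t > 0 \<Longrightarrow> vt x t \<le> (\<Sum>i\<in>UNIV. v2 i x t)"
    and init: "\<And>x. x \<in> D \<Longrightarrow> v x s \<le> 0"
    and x: "x0 \<in> D" "t0 \<in> {s<..<T}"
  shows "v x0 t0 \<le> 0"
proof -
  obtain r where r: "t0 < r" "r < T" using dense x(2) by auto
  have sub': "{s<..<r} \<subseteq> {s<..<T}" using r by auto
  have "compact (closure D \<times> {s..r})"
    using D by (intro compact_Times) (auto simp: compact_closure)
  moreover have "continuous_on (closure D \<times> {s..r}) (\<lambda>(x, t). v x t)"
    using r by (intro continuous_on_subset[OF cont]) auto
  ultimately have "bounded ((\<lambda>(x, t). v x t) ` (closure D \<times> {s..r}))"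
    by (intro compact_imp_bounded compact_continuous_image)
  then obtain B where B: "\<And>x t. x \<in> closure D \<Longrightarrow> t \<in> {s..r} \<Longrightarrow> \<bar>v x t\<bar> \<le> B"
    by (force simp: bounded_iff)
  \<comment> \<open>\<open>k + 2\<close> rather than \<open>k + 1\<close>, since already the first
    time must lie strictly below \<open>r\<close>.\<close>
  define \<tau> where "\<tau> k = s + (r - s) / real (k + 2)" for k
  have \<tau>: "\<tau> k \<in> {s<..<r}" for k
  proof -
    have "(r - s) / real (k + 2) < (r - s) / 1"
      using x r by (intro divide_strict_left_mono) auto
    then show ?thesis using x r by (auto simp: \<tau>_def)
  qed
  have "(\<lambda>k. (r - s) / real (k + 2)) \<longlonglongrightarrow> 0"
    using LIMSEQ_ignore_initial_segment[OF lim_const_over_n[of "r - s"], of 2] by simp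
  then have \<tau>lim: "\<tau> \<longlonglongrightarrow> s"
    unfolding \<tau>_def using tendsto_add[OF tendsto_const] by fastforce
  show ?thesis
  proof (rule heat_comparison_ae[where D = D and v = v and T = r and B = B and \<tau> = \<tau> and N = "{}" and s = s
        and ?x0.0 = x0 and ?t0.0 = t0])
    show "heat_regular D {s<..<r} v vt v1 v2"
      by (rule heat_regular_mono[OF reg _ sub']) auto
    show "continuous_on (closure D \<times> {s<..<r}) (\<lambda>(x, t). v x t)"
      using r by (intro continuous_on_subset[OF cont]) auto
    show "v x t \<le> B" if "x \<in> D" "t \<in> {s<..<r}" for x t
      using B[of x t] that closure_subset by force
    show "\<forall>\<^sub>F k in sequentially. v x (\<tau> k) < e" if "x \<in> D - {}" "e > 0" for x e
    proof -
      have xD: "x \<in> closure D" using that closure_subset by auto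
      have "continuous_on {s..<T} (\<lambda>t. v x t)"
        by (rule continuous_on_compose2[OF cont, of _ "\<lambda>t. (x, t)", simplified])
           (use xD in \<open>auto intro!: continuous_intros\<close>)
      then have "(\<lambda>k. v x (\<tau> k)) \<longlonglongrightarrow> v x s"
        by (rule continuous_on_tendsto_compose[OF _ \<tau>lim]) (use \<tau> x r in \<open>auto intro!: always_eventually less_imp_le intro: less_trans\<close>)
      moreover have "v x s < e" using init[of x] that by auto
      ultimately show ?thesis by (rule order_tendstoD(2))
    qed
  qed (use D bdry sub sub' \<tau> \<tau>lim x r in auto)
qed

section \<open>Derivative rules extracted from \<open>C21_on\<close>\<close>

lemma partially_differentiable_DERIV:
  "partially_differentiable i f x \<Longrightarrow> ((\<lambda>s. f (x + s *\<^sub>R axis i 1)) has_real_derivative partial i f x) (at 0)"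
  unfolding partially_differentiable_def partial_def
  by (simp add: DERIV_deriv_iff_real_differentiable)

text \<open>The mixed second derivatives are kept, since reflected coordinate axes are no longer
  coordinate axes.\<close>

lemma C21_onD:
  assumes "C21_on \<Omega> J u"
  shows "\<And>x t. x \<in> \<Omega> \<Longrightarrow> t \<in> J \<Longrightarrow> (u x has_real_derivative deriv (u x) t) (at t)"
    and "\<And>i x t. x \<in> \<Omega> \<Longrightarrow> t \<in> J \<Longrightarrow>
      ((\<lambda>s. u (x + s *\<^sub>R axis i 1) t) has_real_derivative partial i (\<lambda>y. u y t) x) (at 0)"
    and "\<And>i j x t. x \<in> \<Omega> \<Longrightarrow> t \<in> J \<Longrightarrow>
      ((\<lambda>s. partial j (\<lambda>y. u y t) (x + s *\<^sub>R axis i 1)) has_real_derivative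
        partial i (partial j (\<lambda>y. u y t)) x) (at 0)"
    and "continuous_on (\<Omega> \<times> J) (\<lambda>(x, t). u x t)"
    and "continuous_on (\<Omega> \<times> J) (\<lambda>(x, t). deriv (u x) t)"
    and "\<And>i. continuous_on (\<Omega> \<times> J) (\<lambda>(x, t). partial i (\<lambda>y. u y t) x)"
    and "\<And>i j. continuous_on (\<Omega> \<times> J) (\<lambda>(x, t). partial i (partial j (\<lambda>y. u y t)) x)"
proof -
  fix x t i j assume "x \<in> \<Omega>" "t \<in> J"
  then have "u x differentiable (at t)" "partially_differentiable i (\<lambda>y. u y t) x"
    "partially_differentiable i (partial j (\<lambda>y. u y t)) x"
    using assms by (simp_all add: C21_on_def)
  then show "(u x has_real_derivative deriv (u x) t) (at t)"
    "((\<lambda>s. u (x + s *\<^sub>R axis i 1) t) has_real_derivative partial i (\<lambda>y. u y t) x) (at 0)"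
    "((\<lambda>s. partial j (\<lambda>y. u y t) (x + s *\<^sub>R axis i 1)) has_real_derivative
        partial i (partial j (\<lambda>y. u y t)) x) (at 0)"
    using partially_differentiable_DERIV[of i "\<lambda>y. u y t" x]
      partially_differentiable_DERIV[of i "partial j (\<lambda>y. u y t)" x]
    by (simp_all add: DERIV_deriv_iff_real_differentiable)
next
  note C = assms[unfolded C21_on_def]
  show "continuous_on (\<Omega> \<times> J) (\<lambda>(x, t). u x t)" by (rule C[THEN conjunct1])
  show "continuous_on (\<Omega> \<times> J) (\<lambda>(x, t). deriv (u x) t)"
    by (rule C[THEN conjunct2, THEN conjunct2, THEN conjunct1])
  show "continuous_on (\<Omega> \<times> J) (\<lambda>(x, t). partial i (\<lambda>y. u y t) x)" for i
    by (rule C[THEN conjunct2, THEN conjunct2, THEN conjunct2, THEN conjunct1, rule_format, THEN conjunct2])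
  show "continuous_on (\<Omega> \<times> J) (\<lambda>(x, t). partial i (partial j (\<lambda>y. u y t)) x)" for i j
    by (rule C[THEN conjunct2, THEN conjunct2, THEN conjunct2, THEN conjunct2, rule_format, THEN conjunct2])
qed

lemma heat_regular_C21_on:
  assumes "C21_on \<Omega> J u"
  shows "heat_regular \<Omega> J u (\<lambda>x t. deriv (u x) t) (\<lambda>i x t. partial i (\<lambda>y. u y t) x)
    (\<lambda>i x t. partial i (partial i (\<lambda>y. u y t)) x)"
  unfolding heat_regular_def by (intro conjI ballI allI; rule C21_onD[OF assms]; assumption)

lemma DERIV_along_line:
  fixes f :: "real ^ 'n::finite \<Rightarrow> real"
  assumes "(f has_derivative (\<lambda>v. \<Sum>i\<in>UNIV. v $ i * f' i)) (at x)"
  shows "((\<lambda>s. f (x + s *\<^sub>R d)) has_real_derivative (\<Sum>i\<in>UNIV. d $ i * f' i)) (at 0)"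
proof -
  have "((\<lambda>s. x + s *\<^sub>R d) has_derivative (\<lambda>s. s *\<^sub>R d)) (at (0::real))"
    by (auto intro!: derivative_eq_intros)
  moreover have "(f has_derivative (\<lambda>v. \<Sum>i\<in>UNIV. v $ i * f' i)) (at (x + 0 *\<^sub>R d))"
    using assms by simp
  ultimately have "((\<lambda>s. f (x + s *\<^sub>R d)) has_derivative (\<lambda>s. \<Sum>i\<in>UNIV. (s *\<^sub>R d) $ i * f' i)) (at 0)"
    by (rule has_derivative_compose)
  moreover have "(\<lambda>s. \<Sum>i\<in>UNIV. (s *\<^sub>R d) $ i * f' i) = (*) (\<Sum>i\<in>UNIV. d $ i * f' i)"
    by (auto simp: fun_eq_iff sum_distrib_left mult_ac)
  ultimately show ?thesis
    by (simp only: has_field_derivative_def)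
qed

subsection \<open>Reflections and explicit functions\<close>

text \<open>For a unit vector \<open>e\<close>, the reflection in the hyperplane
  \<open>x \<bullet> e = h\<close>.\<close>

definition mirror :: "real ^ 'n::finite \<Rightarrow> real \<Rightarrow> real ^ 'n \<Rightarrow> real ^ 'n" where
  "mirror e h x = x - (2 * (x \<bullet> e - h)) *\<^sub>R e"

lemma continuous_on_mirror [continuous_intros]:
  "continuous_on S g \<Longrightarrow> continuous_on S (\<lambda>x. mirror e h (g x))"
  unfolding mirror_def by (intro continuous_on_diff continuous_on_scaleR continuous_on_mult continuous_on_inner continuous_on_const)

lemma norm_mirror:
  assumes "norm e = 1"
  shows "(norm (mirror e h x))\<^sup>2 = (norm x)\<^sup>2 - 4 * h * (x \<bullet> e - h)"
proof -
  have "e \<bullet> e = 1" using assms by (simp add: dot_square_norm)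
  then show ?thesis
    unfolding mirror_def power2_norm_eq_inner
    by (simp add: inner_diff_left inner_diff_right inner_commute[of e x] algebra_simps power2_eq_square)
qed

lemma norm_mirror_le:
  assumes "norm e = 1" "h \<ge> 0" "x \<bullet> e \<ge> h"
  shows "norm (mirror e h x) \<le> norm x"
proof (rule power2_le_imp_le)
  have "0 \<le> 4 * h * (x \<bullet> e - h)" using assms by simp
  then show "(norm (mirror e h x))\<^sup>2 \<le> (norm x)\<^sup>2" using norm_mirror[OF assms(1), of h x] by linarith
qed simp

lemma mirror_mirror:
  assumes "norm e = 1"
  shows "mirror e h (mirror e h x) = x"
proof -
  have "e \<bullet> e = 1" using assms by (simp add: dot_square_norm)
  then show ?thesis
    unfolding mirror_def by (simp add: inner_diff_left algebra_simps)
qed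

lemma negligible_mirror_image:
  assumes "negligible N"
  shows "negligible (mirror e h ` N)"
proof (rule negligible_differentiable_image_negligible[OF _ assms])
  have "((\<lambda>x. x - (2 * (x \<bullet> e - h)) *\<^sub>R e) has_derivative (\<lambda>y. y - (2 * (y \<bullet> e)) *\<^sub>R e)) (at x within N)" for x
    by (auto intro!: derivative_eq_intros)
  then show "mirror e h differentiable_on N"
    unfolding mirror_def[abs_def] differentiable_on_def differentiable_def by blast
qed simp

text \<open>The Laplacian commutes with reflections because their linear part is orthogonal.
  Derivatives of the composition run along non-coordinate directions, which calls for total
  differentiability of \<open>u\<close> and of its first partials, and so for the mixed second
  derivatives.\<close>

lemma heat_regular_mirror:
  fixes u :: "real ^ 'n::finite \<Rightarrow> real \<Rightarrow> real"
  assumes C21: "C21_on \<Omega> J u" and \<Omega>: "open \<Omega>" and D: "\<And>x. x \<in> D \<Longrightarrow> mirror e h x \<in> \<Omega>"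
    and e: "norm e = 1"
  obtains w1 w2 where
    "heat_regular D J (\<lambda>x t. u (mirror e h x) t) (\<lambda>x t. deriv (u (mirror e h x)) t) w1 w2"
    "\<And>x t. (\<Sum>i\<in>UNIV. w2 i x t) = laplacian (\<lambda>y. u y t) (mirror e h x)"
proof
  \<comment> \<open>\<open>d i\<close> is the image of the \<open>i\<close>-th axis under the linear
    part of the reflection.\<close>
  define d where "d i = axis i 1 - (2 * e $ i) *\<^sub>R e" for i
  define w1 where "w1 i x t = (\<Sum>j\<in>UNIV. d i $ j * partial j (\<lambda>y. u y t) (mirror e h x))" for i x t
  define w2 where "w2 i x t = (\<Sum>j\<in>UNIV. d i $ j * (\<Sum>k\<in>UNIV. d i $ k *
      partial k (partial j (\<lambda>y. u y t)) (mirror e h x)))" for i x t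
  note C = C21_onD[OF C21]
  have shift: "mirror e h (x + s *\<^sub>R axis i 1) = mirror e h x + s *\<^sub>R d i" for x s i
    unfolding mirror_def d_def
    by (simp add: inner_add_left inner_axis' algebra_simps)
  have slice: "continuous_on \<Omega> (\<lambda>x. H x t)"
    if "continuous_on (\<Omega> \<times> J) (\<lambda>(x, t). H x t)" "t \<in> J" for t and H :: "real ^ 'n \<Rightarrow> real \<Rightarrow> real"
    by (rule continuous_on_compose2[OF that(1), of \<Omega> "\<lambda>x. (x, t)", simplified])
       (use that(2) in \<open>auto intro!: continuous_intros\<close>)
  have comp: "continuous_on (D \<times> J) (\<lambda>p. H (mirror e h (fst p)) (snd p))"
    if "continuous_on (\<Omega> \<times> J) (\<lambda>(x, t). H x t)" for H :: "real ^ 'n \<Rightarrow> real \<Rightarrow> real"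
    by (rule continuous_on_compose2[OF that, of "D \<times> J" "\<lambda>p. (mirror e h (fst p), snd p)", simplified])
       (use D in \<open>auto intro!: continuous_intros\<close>)
  have d1: "((\<lambda>y. u y t) has_derivative (\<lambda>v. \<Sum>i\<in>UNIV. v $ i * partial i (\<lambda>y. u y t) x)) (at x)"
    if "x \<in> \<Omega>" "t \<in> J" for x t
    by (rule has_derivative_from_partials[OF \<Omega> that(1)])
       (rule C(2) slice[OF C(6)]; use that in simp)+
  have d2: "(partial j (\<lambda>y. u y t) has_derivative
      (\<lambda>v. \<Sum>i\<in>UNIV. v $ i * partial i (partial j (\<lambda>y. u y t)) x)) (at x)"
    if "x \<in> \<Omega>" "t \<in> J" for x t j
    by (rule has_derivative_from_partials[OF \<Omega> that(1)])
       (rule C(3) slice[OF C(7)]; use that in simp)+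
  show "heat_regular D J (\<lambda>x t. u (mirror e h x) t) (\<lambda>x t. deriv (u (mirror e h x)) t) w1 w2"
    unfolding heat_regular_def split_beta
  proof (intro conjI ballI allI)
    fix x t i assume x: "x \<in> D" "t \<in> J"
    show "(u (mirror e h x) has_real_derivative deriv (u (mirror e h x)) t) (at t)"
      using C D x by auto
    show "((\<lambda>s. u (mirror e h (x + s *\<^sub>R axis i 1)) t) has_real_derivative w1 i x t) (at 0)"
      unfolding shift w1_def by (intro DERIV_along_line d1 D x)
    show "((\<lambda>s. w1 i (x + s *\<^sub>R axis i 1) t) has_real_derivative w2 i x t) (at 0)"
      unfolding shift w1_def w2_def by (intro DERIV_sum DERIV_cmult DERIV_along_line d2 D x)
  next
    show "continuous_on (D \<times> J) (\<lambda>p. u (mirror e h (fst p)) (snd p))"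
      "continuous_on (D \<times> J) (\<lambda>p. deriv (u (mirror e h (fst p))) (snd p))"
      by (intro comp; use C in simp)+
    fix i
    show "continuous_on (D \<times> J) (\<lambda>p. w1 i (fst p) (snd p))"
      "continuous_on (D \<times> J) (\<lambda>p. w2 i (fst p) (snd p))"
      unfolding w1_def w2_def by (intro continuous_intros comp; use C in simp)+
  qed
  fix x t
  have ee: "(\<Sum>i\<in>UNIV. e $ i * e $ i) = 1"
    using e by (simp add: norm_eq_1 inner_vec_def)
  \<comment> \<open>Orthogonality of the matrix with rows \<open>d i\<close>; the trace of the
    Hessian is therefore unchanged.\<close>
  have orth: "(\<Sum>i\<in>UNIV. d i $ j * d i $ k) = (if j = k then 1 else 0)" for j k
  proof -
    have "(\<Sum>i\<in>UNIV. d i $ j * d i $ k) = (\<Sum>i\<in>UNIV. (if i = j then (if j = k then 1 else 0) else 0)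
        - (if i = j then 2 * e $ j * e $ k else 0) - (if i = k then 2 * e $ j * e $ k else 0)
        + (e $ i * e $ i) * (4 * e $ j * e $ k))"
      by (rule sum.cong) (auto simp: d_def axis_def algebra_simps)
    also have "\<dots> = (if j = k then 1 else 0) - 2 * e $ j * e $ k - 2 * e $ j * e $ k
        + (\<Sum>i\<in>UNIV. e $ i * e $ i) * (4 * e $ j * e $ k)"
      by (simp add: sum.distrib sum_subtractf sum_distrib_right)
    finally show ?thesis by (simp add: ee)
  qed
  let ?H = "\<lambda>j k. partial k (partial j (\<lambda>y. u y t)) (mirror e h x)"
  have "(\<Sum>i\<in>UNIV. w2 i x t) = (\<Sum>i\<in>UNIV. \<Sum>j\<in>UNIV. \<Sum>k\<in>UNIV. d i $ j * d i $ k * ?H j k)"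
    by (simp add: w2_def sum_distrib_left mult.assoc)
  also have "\<dots> = (\<Sum>j\<in>UNIV. \<Sum>i\<in>UNIV. \<Sum>k\<in>UNIV. d i $ j * d i $ k * ?H j k)"
    by (rule sum.swap)
  also have "\<dots> = (\<Sum>j\<in>UNIV. \<Sum>k\<in>UNIV. \<Sum>i\<in>UNIV. d i $ j * d i $ k * ?H j k)"
    by (intro sum.cong refl sum.swap)
  also have "\<dots> = (\<Sum>j\<in>UNIV. \<Sum>k\<in>UNIV. (if j = k then 1 else 0) * ?H j k)"
    by (simp add: sum_distrib_right[symmetric] orth)
  also have "\<dots> = (\<Sum>j\<in>UNIV. \<Sum>k\<in>UNIV. if j = k then ?H j k else 0)"
    by (intro sum.cong) auto
  also have "\<dots> = (\<Sum>j\<in>UNIV. ?H j j)"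
    by simp
  finally show "(\<Sum>i\<in>UNIV. w2 i x t) = laplacian (\<lambda>y. u y t) (mirror e h x)"
    by (simp add: laplacian_def)
qed

text \<open>For a unit \<open>e\<close> the second derivatives add up to
  \<open>f2 (x \<bullet> e - h)\<close>, so on such profiles the heat operator is
  one-dimensional.\<close>

lemma heat_regular_ridge:
  fixes e :: "real ^ 'n::finite"
  assumes "\<And>y. (f has_real_derivative f1 y) (at y)" "\<And>y. (f1 has_real_derivative f2 y) (at y)"
    "continuous_on UNIV f2"
  shows "heat_regular D J (\<lambda>x t. f (x \<bullet> e - h)) (\<lambda>x t. 0)
    (\<lambda>i x t. e $ i * f1 (x \<bullet> e - h)) (\<lambda>i x t. e $ i * (e $ i * f2 (x \<bullet> e - h)))"
proof (rule heat_regular_static)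
  have d: "((\<lambda>s. (x + s *\<^sub>R axis i 1) \<bullet> e - h) has_real_derivative e $ i) (at 0)" for x i
    by (auto simp: inner_add_left inner_axis' intro!: derivative_eq_intros)
  have chain: "((\<lambda>s. g ((x + s *\<^sub>R axis i 1) \<bullet> e - h)) has_real_derivative e $ i * g' (x \<bullet> e - h)) (at 0)"
    if "\<And>y. (g has_real_derivative g' y) (at y)" for g g' x i
    using DERIV_chain2[OF that d, of x i] by (simp add: mult.commute)
  fix i and x :: "real ^ 'n"
  show "((\<lambda>s. f ((x + s *\<^sub>R axis i 1) \<bullet> e - h)) has_real_derivative e $ i * f1 (x \<bullet> e - h)) (at 0)"
    by (rule chain[OF assms(1)])
  show "((\<lambda>s. e $ i * f1 ((x + s *\<^sub>R axis i 1) \<bullet> e - h)) has_real_derivative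
      e $ i * (e $ i * f2 (x \<bullet> e - h))) (at 0)"
    by (rule DERIV_cmult[OF chain[OF assms(2)]])
next
  have c: "continuous_on UNIV f" "continuous_on UNIV f1"
    using assms DERIV_isCont by (blast intro: continuous_at_imp_continuous_on)+
  have *: "continuous_on D (\<lambda>x. g (x \<bullet> e - h))" if "continuous_on UNIV g" for g :: "real \<Rightarrow> real"
    by (rule continuous_on_compose2[OF that]) (auto intro!: continuous_intros)
  show "continuous_on D (\<lambda>x. f (x \<bullet> e - h))" by (rule *[OF c(1)])
  fix i
  show "continuous_on D (\<lambda>x. e $ i * f1 (x \<bullet> e - h))"
    by (intro continuous_intros *[OF c(2)])
  show "continuous_on D (\<lambda>x. e $ i * (e $ i * f2 (x \<bullet> e - h)))"
    by (intro continuous_intros *[OF assms(3)])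
qed

text \<open>The spatial profile of the lower barrier: it vanishes on the sphere
  \<open>norm x = R\<close>, and the free coefficient \<open>A\<close> allows the constant part of
  its Laplacian to be adjusted.\<close>

lemma heat_regular_quartic:
  fixes D :: "(real ^ 'n::finite) set" and R :: real
  defines "b \<equiv> \<lambda>x::real ^ 'n. R\<^sup>2 - x \<bullet> x"
  shows "heat_regular D J (\<lambda>x t. b x + A * (b x)\<^sup>2) (\<lambda>x t. 0)
    (\<lambda>i x t. - 2 * x $ i * (1 + 2 * A * b x)) (\<lambda>i x t. - 2 * (1 + 2 * A * b x) + 8 * A * (x $ i)\<^sup>2)"
proof (rule heat_regular_static)
  have bs: "b (x + s *\<^sub>R axis i 1) = b x - 2 * s * x $ i - s\<^sup>2" for x s i
    by (simp add: b_def inner_add_left inner_add_right inner_axis' inner_axis algebra_simps power2_eq_square)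
  have db: "((\<lambda>s. b (x + s *\<^sub>R axis i 1)) has_real_derivative - 2 * x $ i) (at 0)" for x i
    unfolding bs by (auto intro!: derivative_eq_intros)
  have comp: "(x + s *\<^sub>R axis i 1) $ i = x $ i + s" for x :: "real ^ 'n" and s i by simp
  fix i and x :: "real ^ 'n"
  show "((\<lambda>s. b (x + s *\<^sub>R axis i 1) + A * (b (x + s *\<^sub>R axis i 1))\<^sup>2) has_real_derivative
      - 2 * x $ i * (1 + 2 * A * b x)) (at 0)"
    by (auto intro!: derivative_eq_intros db simp: algebra_simps)
  show "((\<lambda>s. - 2 * (x + s *\<^sub>R axis i 1) $ i * (1 + 2 * A * b (x + s *\<^sub>R axis i 1))) has_real_derivative
      - 2 * (1 + 2 * A * b x) + 8 * A * (x $ i)\<^sup>2) (at 0)"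
    unfolding comp by (auto intro!: derivative_eq_intros db simp: algebra_simps power2_eq_square)
next
  show "continuous_on D (\<lambda>x. b x + A * (b x)\<^sup>2)"
    unfolding b_def by (intro continuous_intros)
  show "continuous_on D (\<lambda>x. - 2 * x $ i * (1 + 2 * A * b x))"
    "continuous_on D (\<lambda>x. - 2 * (1 + 2 * A * b x) + 8 * A * (x $ i)\<^sup>2)" for i
    unfolding b_def by (intro continuous_intros)+
qed

subsection \<open>Reflection inequalities for the solution\<close>

locale radial_solution =
  fixes lam chi R T :: real
    and u0 :: "real ^ 'n::finite \<Rightarrow> real"
    and \<phi> :: "real \<Rightarrow> real"
    and u :: "real ^ 'n \<Rightarrow> real \<Rightarrow> real"
  assumes pos: "lam > 0" "chi > 0" "R > 0" "T > 0"
    and u0_radial: "\<And>x. x \<in> ball 0 R \<Longrightarrow> u0 x = \<phi> (norm x)"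
    and u0_decreasing: "antimono_on {0..R} \<phi>"
    and solution: "nonlocal_solution lam chi (ball 0 R) T u0 u"
    and u_bounds_ball: "\<And>x t. x \<in> ball 0 R \<Longrightarrow> t \<in> {0<..<T} \<Longrightarrow> 0 \<le> u x t \<and> u x t < 1"
begin

text \<open>The nonlocal factor depends on \<open>t\<close> alone. Treated as a given coefficient,
  it is the same for \<open>u\<close> and its mirror image, so the equation can be handled like a
  local one.\<close>

definition k where "k t = lam / (1 + chi * (LINT z:ball 0 R|lebesgue. 1 / (1 - u z t)))\<^sup>2"

lemma C21: "C21_on (ball 0 R) {0<..<T} u"
  and u_continuous: "continuous_on (cball 0 R \<times> {0<..<T}) (\<lambda>(x, t). u x t)"
  and u_frontier: "norm x = R \<Longrightarrow> t \<in> {0<..<T} \<Longrightarrow> u x t = 0"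
  and u0_integrable: "set_integrable lebesgue (ball 0 R) u0"
  and L1_limit: "((\<lambda>t. LINT x:ball 0 R|lebesgue. \<bar>u x t - u0 x\<bar>) \<longlongrightarrow> 0) (at_right 0)"
  using solution pos(3) unfolding nonlocal_solution_def by (auto simp: frontier_ball)

lemma pde:
  assumes "x \<in> ball 0 R" "t \<in> {0<..<T}"
  shows "deriv (u x) t = laplacian (\<lambda>y. u y t) x + k t * (1 / (1 - u x t)\<^sup>2)"
proof -
  have "deriv (u x) t = laplacian (\<lambda>y. u y t) x
      + lam / ((1 - u x t)\<^sup>2 * (1 + chi * (LINT z:ball 0 R|lebesgue. 1 / (1 - u z t)))\<^sup>2)"
    using solution assms unfolding nonlocal_solution_def by blast
  then show ?thesis by (simp add: k_def)
qed

lemma u_bounds: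
  assumes "x \<in> cball 0 R" "t \<in> {0<..<T}"
  shows "0 \<le> u x t" "u x t < 1"
  using u_bounds_ball[of x t] u_frontier[of x t] assms
  by (cases "norm x = R"; force)+

lemma u_le_below_T:
  assumes "0 < r" "r < T"
  obtains m where "0 \<le> m" "m < 1" "\<And>x t. x \<in> cball 0 R \<Longrightarrow> t \<in> {0..r} \<Longrightarrow> u x t \<le> m"
proof -
  obtain m where m: "m < 1" "\<And>x t. x \<in> closure (ball 0 R) \<Longrightarrow> t \<in> {0..r} \<Longrightarrow> u x t \<le> m"
    using solution assms unfolding nonlocal_solution_def by (metis greaterThanLessThan_iff)
  then show ?thesis
    using pos(3) by (intro that[of "max 0 m"]) (auto intro: max.coboundedI2)
qed

lemma k_bounds:
  assumes "t \<in> {0<..<T}"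
  shows "0 < k t" "k t \<le> lam"
proof -
  \<comment> \<open>The Bochner integral of a nonnegative function is nonnegative, integrable or
    not, so no integrability has to be checked here.\<close>
  have "(LINT z:ball 0 R|lebesgue. 1 / (1 - u z t)) \<ge> 0"
    unfolding set_lebesgue_integral_def
    using u_bounds_ball[OF _ assms] by (intro Bochner_Integration.integral_nonneg) (auto simp: indicator_def less_imp_le)
  then have "1 + chi * (LINT z:ball 0 R|lebesgue. 1 / (1 - u z t)) \<ge> 1"
    using pos by simp
  then have Q: "(1 + chi * (LINT z:ball 0 R|lebesgue. 1 / (1 - u z t)))\<^sup>2 \<ge> 1"
    by (rule one_le_power)
  then have "(1 + chi * (LINT z:ball 0 R|lebesgue. 1 / (1 - u z t)))\<^sup>2 > 0"
    by linarith
  then show "0 < k t"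
    unfolding k_def using pos(1) by (rule divide_pos_pos[rotated])
  show "k t \<le> lam"
    unfolding k_def using Q pos(1) divide_left_mono[of 1 _ lam] by simp
qed

text \<open>Away from \<open>T\<close> the solution stays below some \<open>m < 1\<close>, which
  bounds the nonlocal integral by \<open>L\<close>; the constant may degenerate as \<open>r\<close>
  approaches \<open>T\<close>.\<close>

lemma k_lower_bound:
  assumes r: "0 < r" "r < T"
  obtains c where "c > 0" "\<And>t. t \<in> {0<..r} \<Longrightarrow> c \<le> k t"
proof -
  obtain m where m: "0 \<le> m" "m < 1" "\<And>x t. x \<in> cball 0 R \<Longrightarrow> t \<in> {0..r} \<Longrightarrow> u x t \<le> m"
    using u_le_below_T[OF r] by blast
  define L where "L = (LINT z:ball (0::real ^ 'n) R|lebesgue. 1 / (1 - m))"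
  have L: "0 \<le> (LINT z:ball 0 R|lebesgue. 1 / (1 - u z t))"
      "(LINT z:ball 0 R|lebesgue. 1 / (1 - u z t)) \<le> L" if t: "t \<in> {0<..r}" for t
  proof -
    have tT: "t \<in> {0<..<T}" using t r by auto
    show "0 \<le> (LINT z:ball 0 R|lebesgue. 1 / (1 - u z t))"
      unfolding set_lebesgue_integral_def
      using u_bounds_ball[OF _ tT] by (intro Bochner_Integration.integral_nonneg) (auto simp: indicator_def less_imp_le)
    show "(LINT z:ball 0 R|lebesgue. 1 / (1 - u z t)) \<le> L"
      unfolding L_def set_lebesgue_integral_def
    proof (rule integral_mono')
      show "integrable lebesgue (\<lambda>x::real ^ 'n. indicator (ball 0 R) x *\<^sub>R (1 / (1 - m)))"
        by (intro integrable_scaleR_left integrable_real_indicator)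
           (auto simp: emeasure_completion emeasure_lborel_ball_finite[simplified])
      fix x :: "real ^ 'n"
      show "indicator (ball 0 R) x *\<^sub>R (1 / (1 - u x t)) \<le> indicator (ball 0 R) x *\<^sub>R (1 / (1 - m))"
        using m(2) m(3)[of x t] t by (auto simp: indicator_def intro!: divide_left_mono)
      show "0 \<le> indicator (ball 0 R) x *\<^sub>R (1 / (1 - m))"
        using m by auto
    qed
  qed
  show ?thesis
  proof
    have "0 \<le> L" using L[of r] r by auto
    then have L1: "1 + chi * L \<ge> 1" using pos by simp
    show "lam / (1 + chi * L)\<^sup>2 > 0" using pos L1 by auto
    fix t assume t: "t \<in> {0<..r}"
    have "0 \<le> chi * (LINT z:ball 0 R|lebesgue. 1 / (1 - u z t))"
      "chi * (LINT z:ball 0 R|lebesgue. 1 / (1 - u z t)) \<le> chi * L"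
      using L[OF t] pos by auto
    then show "lam / (1 + chi * L)\<^sup>2 \<le> k t"
      unfolding k_def using pos by (intro divide_left_mono power_mono mult_pos_pos zero_less_power) linarith+
  qed
qed

lemma u_slice_set_integrable:
  assumes "t \<in> {0<..<T}"
  shows "set_integrable lebesgue (ball 0 R) (\<lambda>x. u x t)"
proof -
  have "continuous_on (cball 0 R) (\<lambda>x. u x t)"
    by (rule continuous_on_compose2[OF u_continuous, of _ "\<lambda>x. (x, t)", simplified])
       (use assms in \<open>auto intro!: continuous_intros\<close>)
  then have "integrable lborel (\<lambda>x. indicator (cball 0 R) x *\<^sub>R u x t)"
    by (intro borel_integrable_compact) auto
  then have "set_integrable lebesgue (cball 0 R) (\<lambda>x. u x t)"
    unfolding set_integrable_def
    by (intro integrable_completion[THEN iffD2]) (auto dest: borel_measurable_integrable)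
  then show ?thesis by (rule set_integrable_subset) auto
qed

text \<open>Working with an a.e. convergent sequence instead of the \<open>L\<^sup>1\<close> limit means that only null sets,
  not integrals, have to be transported by reflections.\<close>

lemma initial_trace_ae:
  assumes "0 < r" "r \<le> T"
  obtains \<tau> N where "\<And>j. \<tau> j \<in> {0<..<r}" "\<tau> \<longlonglongrightarrow> 0" "negligible N"
    "\<And>x. x \<in> ball 0 R - N \<Longrightarrow> (\<lambda>j. u x (\<tau> j)) \<longlonglongrightarrow> u0 x"
proof -
  define \<tau> where "\<tau> j = r / real (j + 2)" for j
  have \<tau>: "\<tau> j \<in> {0<..<r}" for j
  proof -
    have "r / real (j + 2) < r / 1"
      using assms by (intro divide_strict_left_mono) auto
    then show ?thesis using assms by (auto simp: \<tau>_def)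
  qed
  have \<tau>0: "\<tau> \<longlonglongrightarrow> 0"
    unfolding \<tau>_def using LIMSEQ_ignore_initial_segment[OF lim_const_over_n[of r], of 2] by simp
  define f where "f j x = indicator (ball 0 R) x *\<^sub>R (u x (\<tau> j) - u0 x)" for j x
  have "filterlim \<tau> (at_right 0) sequentially"
    using \<tau>0 \<tau> by (auto simp: filterlim_at intro!: always_eventually) (metis less_irrefl)
  from filterlim_compose[OF L1_limit this]
  have "(\<lambda>j. LINT x:ball 0 R|lebesgue. \<bar>u x (\<tau> j) - u0 x\<bar>) \<longlonglongrightarrow> 0" .
  moreover have "(LINT x:ball 0 R|lebesgue. \<bar>u x (\<tau> j) - u0 x\<bar>) = (LINT x|lebesgue. norm (f j x))" for j
    unfolding f_def set_lebesgue_integral_def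
    by (intro Bochner_Integration.integral_cong) (auto simp: indicator_def)
  moreover have "integrable lebesgue (f j)" for j
    using set_integral_diff(1)[OF u_slice_set_integrable u0_integrable, of "\<tau> j"] \<tau>[of j] assms
    by (auto simp: f_def[abs_def] set_integrable_def)
  \<comment> \<open>Convergence in mean yields almost everywhere convergence along a
    subsequence.\<close>
  ultimately obtain q where q: "strict_mono q" "AE x in lebesgue. (\<lambda>j. f (q j) x) \<longlonglongrightarrow> 0"
    using tendsto_L1_AE_subseq[of lebesgue f] by auto
  from q(2) obtain N where N: "N \<in> null_sets lebesgue" "{x. \<not> (\<lambda>j. f (q j) x) \<longlonglongrightarrow> 0} \<subseteq> N"
    by (auto simp: eventually_ae_filter)
  show ?thesis
  proof (rule that[of "\<tau> \<circ> q" N])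
    show "(\<tau> \<circ> q) j \<in> {0<..<r}" for j using \<tau> by simp
    show "(\<tau> \<circ> q) \<longlonglongrightarrow> 0" using \<tau>0 q(1) by (rule LIMSEQ_subseq_LIMSEQ)
    show "negligible N" using N by (simp add: negligible_iff_null_sets)
    fix x assume x: "x \<in> ball 0 R - N"
    then have "(\<lambda>j. f (q j) x) \<longlonglongrightarrow> 0" using N by auto
    then have "(\<lambda>j. f (q j) x + u0 x) \<longlonglongrightarrow> 0 + u0 x" by (intro tendsto_intros)
    with x show "(\<lambda>j. u x ((\<tau> \<circ> q) j)) \<longlonglongrightarrow> u0 x" by (simp add: f_def)
  qed
qed

definition cap where "cap e h = {x \<in> ball (0::real ^ 'n) R. x \<bullet> e > h}"

lemma open_cap: "open (cap e h)"
  and bounded_cap: "bounded (cap e h)"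
proof -
  have "cap e h = ball 0 R \<inter> {x. x \<bullet> e > h}" by (auto simp: cap_def)
  moreover have "open {x. x \<bullet> e > h}"
    by (intro open_Collect_less continuous_intros)
  ultimately show "open (cap e h)" by (simp add: open_Int)
  show "bounded (cap e h)"
    by (rule bounded_subset[of "ball 0 R"]) (auto simp: cap_def)
qed

lemma closure_cap: "closure (cap e h) \<subseteq> {x \<in> cball 0 R. x \<bullet> e \<ge> h}"
proof (rule closure_minimal)
  have "closed (cball 0 R \<inter> {x. x \<bullet> e \<ge> h})"
    by (intro closed_Int closed_Collect_le continuous_intros) auto
  then show "closed {x \<in> cball 0 R. x \<bullet> e \<ge> h}" by (simp add: Int_def)
qed (auto simp: cap_def)

lemma frontier_cap:
  assumes "x \<in> closure (cap e h) - cap e h"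
  shows "norm x = R \<or> x \<bullet> e = h"
  using assms closure_cap[of e h] by (force simp: cap_def)

lemma mirror_cap:
  assumes "norm e = 1" "h \<ge> 0"
  shows "x \<in> closure (cap e h) \<Longrightarrow> mirror e h x \<in> cball 0 R"
    and "x \<in> cap e h \<Longrightarrow> mirror e h x \<in> ball 0 R"
  using norm_mirror_le[OF assms, of x] closure_cap[of e h]
  by (fastforce simp: cap_def)+

lemma mirror_difference_continuous:
  assumes "norm e = 1" "h \<ge> 0"
  shows "continuous_on (closure (cap e h) \<times> {0<..<T}) (\<lambda>(x, t). u x t - u (mirror e h x) t)"
proof -
  have 1: "continuous_on (closure (cap e h) \<times> {0<..<T}) (\<lambda>p. u (fst p) (snd p))"
    using u_continuous[unfolded split_beta]
    by (rule continuous_on_subset) (use closure_cap[of e h] in blast)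
  have 2: "continuous_on (closure (cap e h) \<times> {0<..<T}) (\<lambda>p. u (mirror e h (fst p)) (snd p))"
    by (rule continuous_on_compose2[OF u_continuous, of _ "\<lambda>p. (mirror e h (fst p), snd p)", simplified])
       (use mirror_cap(1)[OF assms] in \<open>auto intro!: continuous_intros\<close>)
  show ?thesis unfolding split_beta by (intro continuous_on_diff 1 2)
qed

text \<open>Both functions solve the equation with the same coefficient \<open>k t\<close>, so
  subtraction leaves the heat operator plus a difference of the nonlinearity at two values.\<close>

lemma mirror_difference_regular:
  assumes e: "norm e = 1" and h: "h \<ge> 0"
  obtains w1 w2 wt where
    "heat_regular (cap e h) {0<..<T} (\<lambda>x t. u x t - u (mirror e h x) t) wt w1 w2"
    "\<And>x t. x \<in> cap e h \<Longrightarrow> t \<in> {0<..<T} \<Longrightarrow> wt x t = (\<Sum>i\<in>UNIV. w2 i x t)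
        + k t * (1 / (1 - u x t)\<^sup>2 - 1 / (1 - u (mirror e h x) t)\<^sup>2)"
proof -
  obtain m1 m2 where m: "heat_regular (cap e h) {0<..<T} (\<lambda>x t. u (mirror e h x) t)
      (\<lambda>x t. deriv (u (mirror e h x)) t) m1 m2"
    and lap: "\<And>x t. (\<Sum>i\<in>UNIV. m2 i x t) = laplacian (\<lambda>y. u y t) (mirror e h x)"
    using heat_regular_mirror[OF C21 open_ball mirror_cap(2)[OF e h] e] by metis
  have "cap e h \<subseteq> ball 0 R" by (auto simp: cap_def)
  from heat_regular_add[OF heat_regular_mono[OF heat_regular_C21_on[OF C21] this order_refl]
      heat_regular_time_mult[OF m, of "\<lambda>_. - 1" "\<lambda>_. 0"]]
  have reg: "heat_regular (cap e h) {0<..<T} (\<lambda>x t. u x t - u (mirror e h x) t)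
      (\<lambda>x t. deriv (u x) t - deriv (u (mirror e h x)) t)
      (\<lambda>i x t. partial i (\<lambda>y. u y t) x - m1 i x t)
      (\<lambda>i x t. partial i (partial i (\<lambda>y. u y t)) x - m2 i x t)"
    by simp
  show ?thesis
  proof (rule that[OF reg])
    fix x t assume x: "x \<in> cap e h" and t: "t \<in> {0<..<T}"
    have "x \<in> ball 0 R" using x by (auto simp: cap_def)
    then show "deriv (u x) t - deriv (u (mirror e h x)) t
      = (\<Sum>i\<in>UNIV. partial i (partial i (\<lambda>y. u y t)) x - m2 i x t)
        + k t * (1 / (1 - u x t)\<^sup>2 - 1 / (1 - u (mirror e h x) t)\<^sup>2)"
      using mirror_cap(2)[OF e h x] t
      by (simp add: pde sum_subtractf lap algebra_simps) (simp add: laplacian_def)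
  qed
qed

end

section \<open>Estimates for the nonlinearity and the reflection inequality\<close>

lemma inverse_square_diff_le:
  fixes p q m :: real
  assumes "0 \<le> q" "q \<le> p" "p \<le> m" "m < 1"
  shows "1 / (1 - p)\<^sup>2 - 1 / (1 - q)\<^sup>2 \<le> 2 / (1 - m) ^ 4 * (p - q)"
proof -
  have pos: "1 - p > 0" "1 - q > 0" using assms by auto
  have "1 / (1 - p)\<^sup>2 - 1 / (1 - q)\<^sup>2 = ((1 - q)\<^sup>2 - (1 - p)\<^sup>2) / ((1 - p)\<^sup>2 * (1 - q)\<^sup>2)"
    using pos by (subst diff_frac_eq) auto
  \<comment> \<open>The second factor is at most 2 as \<open>p\<close> and \<open>q\<close> are
    nonnegative, and both denominators are at least \<open>(1 - m)\<^sup>2\<close>.\<close>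
  also have "(1 - q)\<^sup>2 - (1 - p)\<^sup>2 = (p - q) * (2 - p - q)"
    by (simp add: algebra_simps power2_eq_square)
  also have "(p - q) * (2 - p - q) / ((1 - p)\<^sup>2 * (1 - q)\<^sup>2) \<le> (p - q) * 2 / ((1 - m)\<^sup>2 * (1 - m)\<^sup>2)"
    using assms by (intro frac_le mult_mono mult_pos_pos power_mono) auto
  also have "(1 - m)\<^sup>2 * (1 - m)\<^sup>2 = (1 - m) ^ 4"
    by (simp add: power_add[symmetric])
  also have "(p - q) * 2 / (1 - m) ^ 4 = 2 / (1 - m) ^ 4 * (p - q)"
    by simp
  finally show ?thesis .
qed

lemma inverse_square_mono:
  fixes p q :: real
  assumes "p \<le> q" "q < 1"
  shows "1 / (1 - p)\<^sup>2 \<le> 1 / (1 - q)\<^sup>2"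
  using assms by (intro divide_left_mono power_mono mult_pos_pos) auto

context radial_solution
begin

lemma u0_mirror:
  assumes e: "norm e = 1" and h: "h \<ge> 0" and x: "x \<in> cap e h"
  shows "u0 x \<le> u0 (mirror e h x)"
proof -
  have "x \<in> ball 0 R" "mirror e h x \<in> ball 0 R" "norm (mirror e h x) \<le> norm x"
    using x mirror_cap(2)[OF e h x] norm_mirror_le[OF e h, of x] by (auto simp: cap_def)
  then show ?thesis
    using u0_decreasing u0_radial by (auto simp: monotone_on_def)
qed

text \<open>The nonlinearity is Lipschitz as long as \<open>u\<close> stays below some
  \<open>m < 1\<close>. Wherever \<open>u\<close> exceeds its mirror image, the factor
  \<open>exp (- K * t)\<close> then absorbs the reaction difference, and the comparison principle
  applies.\<close>

lemma u_mirror: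
  assumes e: "norm e = 1" and h: "h \<ge> 0" and x: "x \<in> cap e h" and t: "t \<in> {0<..<T}"
  shows "u x t \<le> u (mirror e h x) t"
proof -
  let ?D = "cap e h" and ?m = "mirror e h"
  obtain r where r: "t < r" "r < T" using t dense by auto
  then have r0: "0 < r" using t by auto
  obtain m where m: "0 \<le> m" "m < 1" "\<And>x t. x \<in> cball 0 R \<Longrightarrow> t \<in> {0..r} \<Longrightarrow> u x t \<le> m"
    using u_le_below_T[OF r0 r(2)] by blast
  obtain \<tau> N where \<tau>: "\<And>j. \<tau> j \<in> {0<..<r}" "\<tau> \<longlonglongrightarrow> 0" and N: "negligible N"
    "\<And>x. x \<in> ball 0 R - N \<Longrightarrow> (\<lambda>j. u x (\<tau> j)) \<longlonglongrightarrow> u0 x"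
    using initial_trace_ae[OF r0 less_imp_le[OF r(2)]] by blast
  obtain w1 w2 wt where reg: "heat_regular ?D {0<..<T} (\<lambda>x t. u x t - u (?m x) t) wt w1 w2"
    and wt: "\<And>x t. x \<in> ?D \<Longrightarrow> t \<in> {0<..<T} \<Longrightarrow> wt x t = (\<Sum>i\<in>UNIV. w2 i x t)
        + k t * (1 / (1 - u x t)\<^sup>2 - 1 / (1 - u (?m x) t)\<^sup>2)"
    by (rule mirror_difference_regular[OF e h], rule that)
  have rT: "{0<..<r} \<subseteq> {0<..<T}" using r by auto
  \<comment> \<open>The upper bound of \<open>k\<close> times the Lipschitz constant of
    \<open>1 / (1 - p)\<^sup>2\<close> on the values up to \<open>m\<close>; it is available because
    the comparison stops at \<open>r < T\<close>.\<close>
  define K where "K = lam * (2 / (1 - m) ^ 4)"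
  have K: "K \<ge> 0" using pos by (simp add: K_def)
  define v where "v x t = exp (- K * t) * (u x t - u (?m x) t)" for x t
  have "v x t \<le> 0"
  proof (rule heat_comparison_ae[where D = ?D and v = v and s = 0 and T = r and B = 1 and \<tau> = \<tau>
        and N = "N \<union> ?m ` N" and ?x0.0 = x and ?t0.0 = t])
    show "heat_regular ?D {0<..<r} v (\<lambda>x t. - K * exp (- K * t) * (u x t - u (?m x) t) + exp (- K * t) * wt x t)
      (\<lambda>i x t. exp (- K * t) * w1 i x t) (\<lambda>i x t. exp (- K * t) * w2 i x t)"
      unfolding v_def[abs_def]
      by (rule heat_regular_time_mult[OF heat_regular_mono[OF reg order_refl rT]])
         (auto intro!: derivative_eq_intros continuous_intros)
    have c: "continuous_on (closure ?D \<times> {0<..<r}) (\<lambda>p. u (fst p) (snd p) - u (?m (fst p)) (snd p))"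
      using mirror_difference_continuous[OF e h, unfolded split_beta]
      by (rule continuous_on_subset) (use rT in auto)
    show "continuous_on (closure ?D \<times> {0<..<r}) (\<lambda>(x, t). v x t)"
      unfolding v_def split_beta
      by (rule continuous_on_mult[OF _ c]) (intro continuous_intros)
  next
    fix x t assume x: "x \<in> closure ?D - ?D" and "t \<in> {0<..<r}"
    then have t: "t \<in> {0<..<T}" using rT by auto
    \<comment> \<open>On the sphere \<open>u\<close> is 0 and its mirror value nonnegative; on the
      hyperplane the reflection is the identity.\<close>
    have "u x t - u (?m x) t \<le> 0"
      using frontier_cap[OF x] u_frontier[OF _ t, of x] u_bounds(1)[OF mirror_cap(1)[OF e h] t] x
      by (auto simp: mirror_def)
    then show "v x t \<le> 0" by (simp add: v_def mult_nonneg_nonpos)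
  next
    fix x t assume x: "x \<in> ?D" and t: "t \<in> {0<..<r}" and v: "v x t > 0"
    have tT: "t \<in> {0<..<T}" using rT t by auto
    have xb: "x \<in> cball 0 R" using x by (auto simp: cap_def)
    have mx: "?m x \<in> cball 0 R" using mirror_cap(2)[OF e h x] by auto
    have less: "u (?m x) t \<le> u x t" using v by (simp add: v_def zero_less_mult_iff)
    have "k t * (1 / (1 - u x t)\<^sup>2 - 1 / (1 - u (?m x) t)\<^sup>2)
        \<le> lam * (2 / (1 - m) ^ 4 * (u x t - u (?m x) t))"
    proof (rule mult_mono)
      show "1 / (1 - u x t)\<^sup>2 - 1 / (1 - u (?m x) t)\<^sup>2 \<le> 2 / (1 - m) ^ 4 * (u x t - u (?m x) t)"
        using u_bounds(1)[OF mx tT] less m(2) m(3)[OF xb, of t] t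
        by (intro inverse_square_diff_le) auto
      show "0 \<le> 1 / (1 - u x t)\<^sup>2 - 1 / (1 - u (?m x) t)\<^sup>2"
        using inverse_square_mono[OF less u_bounds(2)[OF xb tT]] by simp
    qed (use k_bounds[OF tT] pos in auto)
    then have "wt x t - K * (u x t - u (?m x) t) \<le> (\<Sum>i\<in>UNIV. w2 i x t)"
      by (simp add: wt[OF x tT] K_def mult.assoc)
    then have "exp (- K * t) * (wt x t - K * (u x t - u (?m x) t)) \<le> exp (- K * t) * (\<Sum>i\<in>UNIV. w2 i x t)"
      by (intro mult_left_mono) auto
    then show "- K * exp (- K * t) * (u x t - u (?m x) t) + exp (- K * t) * wt x t
        \<le> (\<Sum>i\<in>UNIV. exp (- K * t) * w2 i x t)"
      by (simp add: sum_distrib_left algebra_simps)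
  next
    fix x t assume x: "x \<in> ?D" and t: "t \<in> {0<..<r}"
    have tT: "t \<in> {0<..<T}" using rT t by auto
    have "u x t - u (?m x) t \<le> 1"
      using x u_bounds_ball[OF _ tT, of x] u_bounds_ball[OF mirror_cap(2)[OF e h x] tT] by (auto simp: cap_def)
    moreover have "exp (- K * t) \<le> 1" using K t by simp
    ultimately have "v x t \<le> exp (- K * t) * 1"
      unfolding v_def by (intro mult_left_mono) auto
    with \<open>exp (- K * t) \<le> 1\<close> show "v x t \<le> 1" by linarith
  next
    fix x and \<epsilon> :: real assume x: "x \<in> ?D - (N \<union> ?m ` N)" and \<epsilon>: "\<epsilon> > 0"
    \<comment> \<open>The reflection is an involution: a point off the mirror image of
      \<open>N\<close> is mapped to a point off \<open>N\<close>, so the initial trace is available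
      at both.\<close>
    have "?m x \<notin> N"
      using x mirror_mirror[OF e, of h x] by (metis DiffD2 UnI2 image_eqI)
    then have "?m x \<in> ball 0 R - N" "x \<in> ball 0 R - N"
      using x mirror_cap(2)[OF e h, of x] by (auto simp: cap_def)
    from N(2)[OF this(1)] N(2)[OF this(2)]
    have "(\<lambda>j. v x (\<tau> j)) \<longlonglongrightarrow> exp (- K * 0) * (u0 x - u0 (?m x))"
      unfolding v_def by (intro tendsto_intros \<tau>(2))
    moreover have "exp (- K * 0) * (u0 x - u0 (?m x)) < \<epsilon>"
      using u0_mirror[OF e h, of x] x \<epsilon> by auto
    ultimately show "\<forall>\<^sub>F j in sequentially. v x (\<tau> j) < \<epsilon>"
      by (rule order_tendstoD(2))
  qed (use open_cap bounded_cap \<tau> N negligible_mirror_image x t r in \<open>auto intro: negligible_Un\<close>)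
  then show ?thesis by (simp add: v_def mult_le_0_iff)
qed

section \<open>A lower bound for the solution near the sphere\<close>

definition b :: "real ^ 'n \<Rightarrow> real" where "b x = R\<^sup>2 - x \<bullet> x"

lemma b_bounds: "x \<in> cball 0 R \<Longrightarrow> 0 \<le> b x" "b x \<le> R\<^sup>2"
  using power_mono[of "norm x" R 2] by (auto simp: b_def dot_square_norm)

text \<open>As \<open>1 / (1 - u x t)\<^sup>2 \<ge> 1\<close>, \<open>u\<close> is a supersolution
  of the heat equation with source \<open>k t\<close>, while \<open>sub\<close> makes the explicit
  product a subsolution; both vanish on the sphere.\<close>

lemma barrier_comparison:
  assumes s: "0 < s" "s < r" "r \<le> T"
    and \<theta>: "\<And>t. t \<in> {s<..<r} \<Longrightarrow> (\<theta> has_real_derivative \<theta>' t) (at t)" "continuous_on {s<..<r} \<theta>'"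
      "continuous_on {s..<r} \<theta>"
    and A: "A \<ge> 0"
    and sub: "\<And>x t. x \<in> ball 0 R \<Longrightarrow> t \<in> {s<..<r} \<Longrightarrow> \<theta>' t * (b x + A * (b x)\<^sup>2)
      \<le> \<theta> t * (- 2 * real CARD('n) * (1 + 2 * A * b x) + 8 * A * (x \<bullet> x)) + k t"
    and init: "\<And>x. x \<in> ball 0 R \<Longrightarrow> \<theta> s * (b x + A * (b x)\<^sup>2) \<le> u x s"
    and x: "x \<in> cball 0 R" and t: "t \<in> {s..<r}"
  shows "\<theta> t * (b x + A * (b x)\<^sup>2) \<le> u x t"
proof -
  have J: "{s<..<r} \<subseteq> {0<..<T}" "{s..<r} \<subseteq> {0<..<T}" using s by auto
  have eq: "\<theta> t * (b x + A * (b x)\<^sup>2) = 0" if "norm x = R" for x t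
    using that by (simp add: b_def dot_square_norm)
  show ?thesis
  \<comment> \<open>The comparison principle covers interior points after time \<open>s\<close>; the
    sphere and the initial time are settled directly.\<close>
  proof (cases "norm x = R \<or> t = s")
    case True
    then show ?thesis
      using eq[of x t] u_bounds(1)[OF x, of t] t J init[of x] x by (cases "norm x = R") auto
  next
    case False
    have "\<theta> t * (b x + A * (b x)\<^sup>2) - u x t \<le> 0"
    proof (rule heat_comparison[where D = "ball 0 R" and s = s and T = r and ?x0.0 = x and ?t0.0 = t
          and v = "\<lambda>x t. \<theta> t * (b x + A * (b x)\<^sup>2) - u x t"])
      have "heat_regular (ball 0 R) {s<..<r} (\<lambda>x t. \<theta> t * (b x + A * (b x)\<^sup>2) + - 1 * u x t)
         (\<lambda>x t. \<theta>' t * (b x + A * (b x)\<^sup>2) + \<theta> t * 0 + (0 * u x t + - 1 * deriv (u x) t))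
         (\<lambda>i x t. \<theta> t * (- 2 * x $ i * (1 + 2 * A * b x)) + - 1 * partial i (\<lambda>y. u y t) x)
         (\<lambda>i x t. \<theta> t * (- 2 * (1 + 2 * A * b x) + 8 * A * (x $ i)\<^sup>2)
           + - 1 * partial i (partial i (\<lambda>y. u y t)) x)"
        unfolding b_def
        by (intro heat_regular_add heat_regular_time_mult \<theta> heat_regular_quartic
            heat_regular_mono[OF heat_regular_C21_on[OF C21] order_refl J(1)]) auto
      then show "heat_regular (ball 0 R) {s<..<r} (\<lambda>x t. \<theta> t * (b x + A * (b x)\<^sup>2) - u x t)
         (\<lambda>x t. \<theta>' t * (b x + A * (b x)\<^sup>2) - deriv (u x) t)
         (\<lambda>i x t. \<theta> t * (- 2 * x $ i * (1 + 2 * A * b x)) - partial i (\<lambda>y. u y t) x)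
         (\<lambda>i x t. \<theta> t * (- 2 * (1 + 2 * A * b x) + 8 * A * (x $ i)\<^sup>2)
           - partial i (partial i (\<lambda>y. u y t)) x)"
        by simp
      have "continuous_on (cball 0 R \<times> {s..<r}) (\<lambda>p. u (fst p) (snd p))"
        using u_continuous[unfolded split_beta] by (rule continuous_on_subset) (use J in auto)
      moreover have "continuous_on (cball (0::real ^ 'n) R \<times> {s..<r}) (\<lambda>p. \<theta> (snd p))"
        by (rule continuous_on_compose2[OF \<theta>(3)]) (auto intro!: continuous_intros)
      ultimately show "continuous_on (closure (ball 0 R) \<times> {s..<r})
          (\<lambda>(x, t). \<theta> t * (b x + A * (b x)\<^sup>2) - u x t)"
        using pos unfolding split_beta b_def by (auto intro!: continuous_intros)
    next
      fix x :: "real ^ 'n" and t assume x: "x \<in> ball 0 R" and t: "t \<in> {s<..<r}"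
      then have tT: "t \<in> {0<..<T}" using J by auto
      have xx: "(\<Sum>i\<in>UNIV. (x $ i)\<^sup>2) = x \<bullet> x"
        by (simp add: inner_vec_def power2_eq_square)
      have "(\<Sum>i\<in>UNIV. \<theta> t * (- 2 * (1 + 2 * A * b x) + 8 * A * (x $ i)\<^sup>2)
          - partial i (partial i (\<lambda>y. u y t)) x)
        = \<theta> t * (- 2 * real CARD('n) * (1 + 2 * A * b x) + 8 * A * (x \<bullet> x)) - laplacian (\<lambda>y. u y t) x"
        by (simp add: sum_subtractf laplacian_def sum_distrib_left[symmetric] sum.distrib xx)
          (simp add: algebra_simps)
      moreover have "k t * 1 \<le> k t * (1 / (1 - u x t)\<^sup>2)"
        using k_bounds(1)[OF tT] u_bounds_ball[OF x tT] inverse_square_mono[of 0 "u x t"]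
        by (intro mult_left_mono) auto
      ultimately show "\<theta>' t * (b x + A * (b x)\<^sup>2) - deriv (u x) t
        \<le> (\<Sum>i\<in>UNIV. \<theta> t * (- 2 * (1 + 2 * A * b x) + 8 * A * (x $ i)\<^sup>2)
          - partial i (partial i (\<lambda>y. u y t)) x)"
        using sub[OF x t] pde[OF x tT] by simp
    next
      fix x :: "real ^ 'n" and t assume "x \<in> closure (ball 0 R) - ball 0 R" "t \<in> {s<..<r}"
      then show "\<theta> t * (b x + A * (b x)\<^sup>2) - u x t \<le> 0"
        using eq[of x t] u_frontier[of x t] J pos by auto
    qed (use x t init False in auto)
    then show ?thesis by simp
  qed
qed

text \<open>Two stages. From \<open>T/4\<close> to \<open>T/2\<close> a positive lower bound on
  \<open>k\<close> builds up a multiple of \<open>b\<close>. From \<open>T/2\<close> on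
  \<open>k\<close> may tend to 0, so an exponentially decaying profile takes over that uses only
  \<open>k > 0\<close>.\<close>

lemma lower_bound:
  obtains \<epsilon> where "\<epsilon> > 0" "\<And>x t. x \<in> cball 0 R \<Longrightarrow> t \<in> {T/2..<T} \<Longrightarrow> \<epsilon> * b x \<le> u x t"
proof -
  let ?n = "real CARD('n)"
  obtain c where c: "c > 0" "\<And>t. t \<in> {0<..3/4*T} \<Longrightarrow> c \<le> k t"
    using k_lower_bound[of "3/4*T"] pos by auto
  \<comment> \<open>With this \<open>\<eta>\<close> the product
    \<open>\<eta> * (t - T/4) * b x\<close> needs a source of at most \<open>c\<close>: its time
    derivative is at most \<open>\<eta> * R\<^sup>2\<close>, and minus its Laplacian is
    \<open>\<eta> * (2 * ?n * (t - T/4))\<close>.\<close>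
  define \<eta> where "\<eta> = c / (R\<^sup>2 + 2 * ?n * T)"
  have den: "R\<^sup>2 + 2 * ?n * T > 0" using pos by (simp add: add_pos_nonneg)
  have \<eta>: "\<eta> > 0" "\<eta> * (R\<^sup>2 + 2 * ?n * T) = c" using c den by (auto simp: \<eta>_def)
  have 1: "\<eta> * (T/2 - T/4) * b x \<le> u x (T/2)" if x: "x \<in> cball 0 R" for x
  proof -
    have "\<eta> * (T/2 - T/4) * (b x + 0 * (b x)\<^sup>2) \<le> u x (T/2)"
    proof (rule barrier_comparison[where s = "T/4" and r = "3/4*T" and \<theta> = "\<lambda>t. \<eta> * (t - T/4)" and \<theta>' = "\<lambda>_. \<eta>"])
      fix y t assume y: "y \<in> ball (0::real ^ 'n) R" and t: "t \<in> {T/4<..<3/4*T}"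
      have "\<eta> * b y + \<eta> * (2 * ?n * (t - T/4)) \<le> \<eta> * R\<^sup>2 + \<eta> * (2 * ?n * T)"
        using \<eta> b_bounds(2)[of y] t pos by (intro add_mono mult_left_mono) auto
      also have "\<dots> = c" using \<eta>(2) by (simp add: algebra_simps)
      also have "\<dots> \<le> k t" using c(2)[of t] t pos by auto
      finally show "\<eta> * (b y + 0 * (b y)\<^sup>2) \<le> \<eta> * (t - T/4) * (- 2 * ?n * (1 + 2 * 0 * b y) + 8 * 0 * (y \<bullet> y)) + k t"
        by (simp add: algebra_simps)
    next
      fix y assume "y \<in> ball (0::real ^ 'n) R"
      then show "\<eta> * (T/4 - T/4) * (b y + 0 * (b y)\<^sup>2) \<le> u y (T/4)"
        using u_bounds_ball[of y "T/4"] pos by auto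
    qed (use pos x in \<open>auto intro!: derivative_eq_intros continuous_intros\<close>)
    then show ?thesis by simp
  qed
  \<comment> \<open>With this \<open>A\<close> the constant terms of the Laplacian of \<open>b + A b\<^sup>2\<close> cancel, leaving \<open>- K b\<close>.\<close>
  define A where "A = ?n / (4 * R\<^sup>2)"
  define K where "K = (4 * ?n + 8) * A"
  have A: "A \<ge> 0" by (simp add: A_def)
  have AR: "8 * A * R\<^sup>2 = 2 * ?n" using pos by (simp add: A_def)
  have K: "K \<ge> 0" using A by (simp add: K_def)
  \<comment> \<open>Matches the two stages at \<open>T/2\<close>, since
    \<open>b x + A * (b x)\<^sup>2 \<le> (1 + A * R\<^sup>2) * b x\<close>.\<close>
  define \<eta>2 where "\<eta>2 = \<eta> * (T/4) / (1 + A * R\<^sup>2)"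
  have den2: "1 + A * R\<^sup>2 > 0" using A by (simp add: add_pos_nonneg)
  have \<eta>2: "\<eta>2 > 0" "\<eta>2 * (1 + A * R\<^sup>2) = \<eta> * (T/4)" using \<eta> pos den2 eq_divide_eq[of \<eta>2 "\<eta> * (T/4)" "1 + A * R\<^sup>2"] by (auto simp: \<eta>2_def)
  have 2: "\<eta>2 * exp (- K * t) * (b x + A * (b x)\<^sup>2) \<le> u x t" if x: "x \<in> cball 0 R" and t: "t \<in> {T/2..<T}" for x t
  proof (rule barrier_comparison[where s = "T/2" and r = T and \<theta>' = "\<lambda>t. - K * (\<eta>2 * exp (- K * t))"])
    fix y t assume y: "y \<in> ball (0::real ^ 'n) R" and t: "t \<in> {T/2<..<T}"
    have by0: "b y \<ge> 0" using y by (intro b_bounds) auto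
    have "8 * A * (y \<bullet> y) = 2 * ?n - 8 * A * b y"
      using AR by (simp add: b_def algebra_simps)
    then have "- 2 * ?n * (1 + 2 * A * b y) + 8 * A * (y \<bullet> y) = - (K * b y)"
      by (simp add: K_def algebra_simps)
    moreover have "- (K * (b y + A * (b y)\<^sup>2)) \<le> - (K * b y)"
      using K A by (simp add: mult_left_mono)
    ultimately have "\<eta>2 * exp (- K * t) * (- (K * (b y + A * (b y)\<^sup>2)))
      \<le> \<eta>2 * exp (- K * t) * (- 2 * ?n * (1 + 2 * A * b y) + 8 * A * (y \<bullet> y))"
      using \<eta>2(1) by (intro mult_left_mono) auto
    moreover have "0 < k t" using t pos by (intro k_bounds) auto
    ultimately show "- K * (\<eta>2 * exp (- K * t)) * (b y + A * (b y)\<^sup>2)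
      \<le> \<eta>2 * exp (- K * t) * (- 2 * ?n * (1 + 2 * A * b y) + 8 * A * (y \<bullet> y)) + k t"
      by (simp add: algebra_simps)
  next
    fix y assume y: "y \<in> ball (0::real ^ 'n) R"
    then have by0: "b y \<ge> 0" by (intro b_bounds) auto
    have "b y + A * (b y)\<^sup>2 \<le> (1 + A * R\<^sup>2) * b y"
      using mult_left_mono[OF mult_right_mono[OF b_bounds(2)[of y] by0] A]
      by (simp add: algebra_simps power2_eq_square)
    moreover have "0 \<le> b y + A * (b y)\<^sup>2" using by0 A by simp
    moreover have "exp (- K * (T/2)) \<le> 1" using K pos by simp
    ultimately have "exp (- K * (T/2)) * (b y + A * (b y)\<^sup>2) \<le> 1 * ((1 + A * R\<^sup>2) * b y)"
      by (intro mult_mono) auto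
    then have "\<eta>2 * (exp (- K * (T/2)) * (b y + A * (b y)\<^sup>2)) \<le> \<eta>2 * (1 * ((1 + A * R\<^sup>2) * b y))"
      using \<eta>2(1) by (intro mult_left_mono) auto
    also have "\<dots> = \<eta>2 * (1 + A * R\<^sup>2) * b y" by (simp only: mult_1_left mult.assoc)
    also have "\<dots> = \<eta> * (T/2 - T/4) * b y" unfolding \<eta>2(2) by simp
    also have "\<dots> \<le> u y (T/2)" using 1[of y] y by auto
    finally show "\<eta>2 * exp (- K * (T/2)) * (b y + A * (b y)\<^sup>2) \<le> u y (T/2)" by (simp add: mult.assoc)
  qed (use pos x t A in \<open>auto intro!: derivative_eq_intros continuous_intros\<close>)
  show ?thesis
  proof (rule that[of "\<eta>2 * exp (- K * T)"])
    show "\<eta>2 * exp (- K * T) > 0" using \<eta>2 by simp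
    fix x t assume x: "x \<in> cball (0::real ^ 'n) R" and t: "t \<in> {T/2..<T}"
    have "\<eta>2 * exp (- K * T) * b x \<le> \<eta>2 * exp (- K * t) * (b x + A * (b x)\<^sup>2)"
      using \<eta>2(1) K t A b_bounds(1)[OF x] by (intro mult_mono) (auto intro!: mult_left_mono)
    with 2[OF x t] show "\<eta>2 * exp (- K * T) * b x \<le> u x t" by linarith
  qed
qed

end

section \<open>Quadratic gap between the origin and other points\<close>

lemma sinh_bounds:
  fixes z :: real
  assumes "z \<ge> 0"
  shows "z \<le> sinh z" "sinh z \<le> z * exp z"
proof -
  \<comment> \<open>Mean value theorem for \<open>sinh\<close>; both bounds then follow from
    \<open>1 \<le> cosh \<xi>\<close> and \<open>cosh \<xi> \<le> exp z\<close>.\<close>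
  obtain \<xi> where \<xi>: "0 \<le> \<xi>" "\<xi> \<le> z" "sinh z = z * cosh \<xi>"
  proof (cases "z = 0")
    case False
    then have "\<exists>\<xi>>0. \<xi> < z \<and> sinh z - sinh 0 = (z - 0) * cosh \<xi>"
      using assms by (intro MVT2) (auto intro!: derivative_eq_intros)
    then show ?thesis using that by auto
  qed (use that[of 0] in auto)
  have avg: "(p + q) / 2 \<le> r" if "p \<le> r" "q \<le> r" for p q r :: real
    using that by simp
  have "cosh \<xi> = (exp \<xi> + exp (- \<xi>)) / 2" by (simp add: cosh_def)
  also have "\<dots> \<le> exp z"
    using \<xi> by (intro avg) auto
  finally show "sinh z \<le> z * exp z" using \<xi> assms by (simp add: mult_left_mono)
  show "z \<le> sinh z" using \<xi> assms mult_left_mono[of 1 "cosh \<xi>" z] cosh_real_ge_1[of \<xi>] by simp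
qed

context radial_solution
begin

lemma reflect_to_origin:
  assumes x: "x \<in> ball 0 R" "x \<noteq> 0"
  defines "e \<equiv> (1 / norm x) *\<^sub>R x" and "h \<equiv> norm x / 2"
  shows "norm e = 1" "h > 0" "x \<in> cap e h" "mirror e h x = 0" "x \<bullet> e = norm x"
proof -
  show xe: "x \<bullet> e = norm x"
    using x by (simp add: e_def dot_square_norm power2_eq_square)
  show "norm e = 1" "h > 0" using x by (auto simp: e_def h_def)
  show "x \<in> cap e h" using x xe by (simp add: cap_def h_def)
  show "mirror e h x = 0"
    unfolding mirror_def xe using x by (simp add: h_def e_def)
qed

lemma u_le_origin:
  assumes x: "x \<in> ball 0 R" and t: "t \<in> {0<..<T}"
  shows "u x t \<le> u 0 t"
proof (cases "x = 0")
  case False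
  from reflect_to_origin[OF x this] u_mirror[OF _ _ _ t] show ?thesis by (metis less_imp_le)
qed simp

text \<open>One factor \<open>h\<close> is the amplitude of the barrier, the other is the distance
  of \<open>x0\<close> from the hyperplane, and \<open>h * h\<close> is a quarter of
  \<open>(norm x0)\<^sup>2\<close>. All constants are fixed before \<open>x0\<close> is, so
  \<open>C\<close> is uniform.\<close>

lemma quadratic_separation:
  obtains C where "C > 0" "\<And>x t. x \<in> ball 0 R \<Longrightarrow> t \<in> {3/4*T..<T} \<Longrightarrow> C * (norm x)\<^sup>2 \<le> u 0 t - u x t"
proof -
  obtain \<epsilon> where \<epsilon>: "\<epsilon> > 0" "\<And>x t. x \<in> cball 0 R \<Longrightarrow> t \<in> {T/2..<T} \<Longrightarrow> \<epsilon> * b x \<le> u x t"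
    using lower_bound by blast
  \<comment> \<open>The barrier is \<open>\<delta> h (exp (\<mu>\<^sup>2 (t - T/2)) sinh (\<mu> s) - \<mu> E s)\<close>. It is nonpositive at \<open>t = T/2\<close>, and \<open>\<mu>\<close> is
    chosen so that the exponential exceeds \<open>E = exp (\<mu> R)\<close> from \<open>t = 3T/4\<close> on.\<close>
  define \<mu> where "\<mu> = 8 * R / T"
  have \<mu>: "\<mu> > 0" "\<mu>\<^sup>2 * (T/4) = 2 * (\<mu> * R)"
    using pos by (auto simp: \<mu>_def power2_eq_square)
  define E where "E = exp (\<mu> * R)"
  have E: "E > 0" by (simp add: E_def)
  \<comment> \<open>Chosen so that on the spherical boundary the \<open>sinh\<close> part is at most
    \<open>4 * \<epsilon> * (h * s)\<close> with \<open>s = x \<bullet> e - h\<close>, which is the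
    value of \<open>\<epsilon> * b\<close> at the mirror point.\<close>
  define \<delta> where "\<delta> = 4 * \<epsilon> / (exp (\<mu>\<^sup>2 * T) * (\<mu> * E))"
  have \<delta>: "\<delta> > 0" "\<delta> * (exp (\<mu>\<^sup>2 * T) * (\<mu> * E)) = 4 * \<epsilon>"
    using \<epsilon>(1) \<mu>(1) E by (auto simp: \<delta>_def)
  have sinh_le: "sinh (\<mu> * y) \<le> \<mu> * E * y" if "0 \<le> y" "y \<le> R" for y
  proof -
    have "sinh (\<mu> * y) \<le> \<mu> * y * exp (\<mu> * y)" using that \<mu>(1) by (intro sinh_bounds) auto
    also have "\<dots> \<le> \<mu> * y * E" unfolding E_def using that \<mu>(1) by (intro mult_left_mono) auto
    finally show ?thesis by (simp add: mult_ac)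
  qed
  \<comment> \<open>The barrier at \<open>x0\<close> divided by \<open>(norm x0)\<^sup>2\<close>,
    after using \<open>sinh z \<ge> z\<close> and replacing the exponential by its least value
    \<open>exp (2 * (\<mu> * R))\<close>; positive because \<open>E = exp (\<mu> * R)\<close> is
    smaller.\<close>
  define C where "C = \<delta> * \<mu> * (exp (2 * (\<mu> * R)) - E) / 4"
  show ?thesis
  proof (rule that[of C])
    have "\<mu> * R < 2 * (\<mu> * R)" using \<mu> pos by simp
    then show "C > 0" unfolding C_def E_def using \<delta>(1) \<mu>(1) by simp
    fix x0 t0 assume x0: "x0 \<in> ball (0::real ^ 'n) R" and t0: "t0 \<in> {3/4*T..<T}"
    show "C * (norm x0)\<^sup>2 \<le> u 0 t0 - u x0 t0"
    proof (cases "x0 = 0")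
      case False
      define e where "e = (1 / norm x0) *\<^sub>R x0"
      define h where "h = norm x0 / 2"
      note r = reflect_to_origin[OF x0 False, folded e_def h_def]
      have h: "h \<ge> 0" using r(2) by simp
      have ee: "(\<Sum>i\<in>UNIV. e $ i * e $ i) = 1"
        using r(1) by (simp add: norm_eq_1 inner_vec_def)
      let ?D = "cap e h" and ?m = "mirror e h" and ?J = "{T/2<..<T}"
      have J: "?J \<subseteq> {0<..<T}" "{T/2..<T} \<subseteq> {0<..<T}" using pos by auto
      obtain w1 w2 wt where reg: "heat_regular ?D {0<..<T} (\<lambda>x t. u x t - u (?m x) t) wt w1 w2"
        and wt: "\<And>x t. x \<in> ?D \<Longrightarrow> t \<in> {0<..<T} \<Longrightarrow> wt x t = (\<Sum>i\<in>UNIV. w2 i x t)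
          + k t * (1 / (1 - u x t)\<^sup>2 - 1 / (1 - u (?m x) t)\<^sup>2)"
        by (rule mirror_difference_regular[OF r(1) h], rule that)
      define \<theta> where "\<theta> t = \<delta> * h * exp (\<mu>\<^sup>2 * (t - T/2))" for t
      define c where "c = \<delta> * h * (\<mu> * E)"
      have \<theta>0: "\<theta> t \<ge> 0" for t using \<delta>(1) h by (simp add: \<theta>_def)
      have c0: "c \<ge> 0" using \<delta>(1) h \<mu>(1) E by (simp add: c_def)
      have cap_range: "0 \<le> x \<bullet> e - h \<and> x \<bullet> e - h \<le> R" if "x \<in> closure ?D" for x
      proof -
        have "x \<bullet> e \<le> norm x * norm e" by (rule norm_cauchy_schwarz)
        then show ?thesis using closure_cap[of e h] that h r(1) by auto
      qed
      \<comment> \<open>\<open>V \<le> 0\<close> states that the barrier lies below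
        \<open>u (?m x) t - u x t\<close>.\<close>
      define V where "V x t = (u x t - u (?m x) t) + (\<theta> t * sinh (\<mu> * (x \<bullet> e - h)) + (- c) * (x \<bullet> e - h))" for x t
      have "V x0 t0 \<le> 0"
      proof (rule heat_comparison[where D = ?D and v = V and s = "T/2" and T = T and ?x0.0 = x0 and ?t0.0 = t0])
        have ridge1: "heat_regular ?D ?J (\<lambda>x t. sinh (\<mu> * (x \<bullet> e - h))) (\<lambda>x t. 0)
            (\<lambda>i x t. e $ i * (\<mu> * cosh (\<mu> * (x \<bullet> e - h))))
            (\<lambda>i x t. e $ i * (e $ i * (\<mu>\<^sup>2 * sinh (\<mu> * (x \<bullet> e - h)))))"
          by (rule heat_regular_ridge)
             (auto intro!: derivative_eq_intros continuous_intros simp: power2_eq_square)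
        have ridge2: "heat_regular ?D ?J (\<lambda>x t. x \<bullet> e - h) (\<lambda>x t. 0)
            (\<lambda>i x t. e $ i * 1) (\<lambda>i x t. e $ i * (e $ i * 0))"
          by (rule heat_regular_ridge) (auto intro!: derivative_eq_intros)
        show "heat_regular ?D ?J V
            (\<lambda>x t. wt x t + ((\<mu>\<^sup>2 * \<theta> t * sinh (\<mu> * (x \<bullet> e - h)) + \<theta> t * 0) + (0 * (x \<bullet> e - h) + (- c) * 0)))
            (\<lambda>i x t. w1 i x t + (\<theta> t * (e $ i * (\<mu> * cosh (\<mu> * (x \<bullet> e - h)))) + (- c) * (e $ i * 1)))
            (\<lambda>i x t. w2 i x t + (\<theta> t * (e $ i * (e $ i * (\<mu>\<^sup>2 * sinh (\<mu> * (x \<bullet> e - h)))))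
              + (- c) * (e $ i * (e $ i * 0))))"
          unfolding V_def[abs_def]
        proof (intro heat_regular_add heat_regular_time_mult ridge1 ridge2
            heat_regular_mono[OF reg order_refl J(1)])
          show "(\<theta> has_real_derivative \<mu>\<^sup>2 * \<theta> t) (at t)" for t
            unfolding \<theta>_def[abs_def] by (auto intro!: derivative_eq_intros)
          show "continuous_on ?J (\<lambda>t. \<mu>\<^sup>2 * \<theta> t)"
            unfolding \<theta>_def by (intro continuous_intros)
        qed auto
        have "continuous_on (closure ?D \<times> {T/2..<T}) (\<lambda>p. u (fst p) (snd p) - u (?m (fst p)) (snd p))"
          using mirror_difference_continuous[OF r(1) h, unfolded split_beta]
          by (rule continuous_on_subset) (use J in auto)
        then show "continuous_on (closure ?D \<times> {T/2..<T}) (\<lambda>(x, t). V x t)"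
          unfolding V_def split_beta \<theta>_def
          by (rule continuous_on_add) (intro continuous_intros)
      next
        fix x t assume x: "x \<in> closure ?D - ?D" and tJ: "t \<in> ?J"
        then have t: "t \<in> {0<..<T}" using J by auto
        let ?y = "x \<bullet> e - h"
        show "V x t \<le> 0"
        proof (cases "?y = 0")
          case True
          then show ?thesis by (simp add: V_def mirror_def)
        next
          case False
          then have nx: "norm x = R" using frontier_cap[OF x] by auto
          have y: "0 \<le> ?y" "?y \<le> R" using cap_range x by auto
          have "\<epsilon> * b (?m x) \<le> u (?m x) t"
            using mirror_cap(1)[OF r(1) h] x tJ by (intro \<epsilon>(2)) auto
          also have "b (?m x) = 4 * h * ?y"
            using norm_mirror[OF r(1), of h x] nx by (simp add: b_def dot_square_norm)
          finally have 1: "4 * \<epsilon> * (h * ?y) \<le> u (?m x) t" by (simp add: mult_ac)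
          have "\<theta> t * sinh (\<mu> * ?y) \<le> \<delta> * h * exp (\<mu>\<^sup>2 * T) * (\<mu> * E * ?y)"
            unfolding \<theta>_def using \<delta>(1) h sinh_le[OF y] tJ y \<mu>(1) pos
            by (intro mult_mono mult_left_mono) (auto intro!: mult_left_mono)
          also have "\<dots> = \<delta> * (exp (\<mu>\<^sup>2 * T) * (\<mu> * E)) * (h * ?y)" by (simp add: mult_ac)
          also have "\<dots> = 4 * \<epsilon> * (h * ?y)" by (simp only: \<delta>(2))
          finally have 2: "\<theta> t * sinh (\<mu> * ?y) \<le> 4 * \<epsilon> * (h * ?y)" .
          have "c * ?y \<ge> 0" using c0 y by simp
          with 1 2 u_frontier[OF nx t] show ?thesis by (simp add: V_def)
        qed
      next
        fix x t assume x: "x \<in> ?D" and t: "t \<in> ?J"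
        then have tT: "t \<in> {0<..<T}" using J by auto
        have "1 / (1 - u x t)\<^sup>2 \<le> 1 / (1 - u (?m x) t)\<^sup>2"
          using u_mirror[OF r(1) h x tT] u_bounds_ball[OF mirror_cap(2)[OF r(1) h x] tT]
          by (intro inverse_square_mono) auto
        then have "k t * (1 / (1 - u x t)\<^sup>2 - 1 / (1 - u (?m x) t)\<^sup>2) \<le> 0"
          using k_bounds(1)[OF tT] by (simp add: mult_nonneg_nonpos)
        moreover have "(\<Sum>i\<in>UNIV. \<theta> t * (e $ i * (e $ i * (\<mu>\<^sup>2 * sinh (\<mu> * (x \<bullet> e - h))))))
            = (\<Sum>i\<in>UNIV. e $ i * e $ i) * (\<mu>\<^sup>2 * \<theta> t * sinh (\<mu> * (x \<bullet> e - h)))"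
          unfolding sum_distrib_right by (intro sum.cong) (auto simp: mult_ac)
        ultimately show "wt x t + ((\<mu>\<^sup>2 * \<theta> t * sinh (\<mu> * (x \<bullet> e - h)) + \<theta> t * 0) + (0 * (x \<bullet> e - h) + (- c) * 0))
          \<le> (\<Sum>i\<in>UNIV. w2 i x t + (\<theta> t * (e $ i * (e $ i * (\<mu>\<^sup>2 * sinh (\<mu> * (x \<bullet> e - h)))))
              + (- c) * (e $ i * (e $ i * 0))))"
          by (simp add: wt[OF x tT] sum.distrib ee)
      next
        fix x assume x: "x \<in> ?D"
        then have y: "0 \<le> x \<bullet> e - h" "x \<bullet> e - h \<le> R"
          using cap_range closure_subset by blast+
        \<comment> \<open>At \<open>T/2\<close> the exponential is 1 and the linear term outweighs
          the \<open>sinh\<close> term.\<close>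
        have "\<delta> * h * sinh (\<mu> * (x \<bullet> e - h)) \<le> \<delta> * h * (\<mu> * E * (x \<bullet> e - h))"
          using sinh_le[OF y] \<delta>(1) h by (intro mult_left_mono) auto
        moreover have "u x (T/2) \<le> u (?m x) (T/2)"
          using pos by (intro u_mirror r h x) auto
        ultimately show "V x (T/2) \<le> 0" by (simp add: V_def \<theta>_def c_def mult.assoc)
      qed (use open_cap bounded_cap r t0 pos in auto)
      then have V: "\<theta> t0 * sinh (\<mu> * h) - c * h \<le> u 0 t0 - u x0 t0"
        unfolding V_def r(4,5) by (simp add: h_def)
      have "\<mu>\<^sup>2 * (T/4) \<le> \<mu>\<^sup>2 * (t0 - T/2)"
        using t0 by (intro mult_left_mono) auto
      then have "exp (2 * (\<mu> * R)) \<le> exp (\<mu>\<^sup>2 * (t0 - T/2))"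
        by (simp only: exp_le_cancel_iff \<mu>(2))
      then have "exp (2 * (\<mu> * R)) * (\<mu> * h) \<le> exp (\<mu>\<^sup>2 * (t0 - T/2)) * sinh (\<mu> * h)"
        using \<mu> h by (intro mult_mono sinh_bounds) auto
      then have "\<delta> * h * (exp (2 * (\<mu> * R)) * (\<mu> * h)) \<le> \<theta> t0 * sinh (\<mu> * h)"
        unfolding \<theta>_def mult.assoc using \<delta>(1) h by (intro mult_left_mono) auto
      moreover have "C * (norm x0)\<^sup>2 = \<delta> * h * (exp (2 * (\<mu> * R)) * (\<mu> * h)) - c * h"
        by (simp add: C_def c_def h_def field_simps power2_eq_square)
      ultimately show ?thesis using V by linarith
    qed simp
  qed
qed

section \<open>Touchdown at the origin and the quenching set\<close>

lemma origin_limit: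
  assumes "touches_down_at (ball 0 R) T u"
  shows "((\<lambda>t. u 0 t) \<longlongrightarrow> 1) (at_left T)"
proof -
  have "(SUP x\<in>ball 0 R. u x t) = u 0 t" if "t \<in> {0<..<T}" for t
    using pos u_le_origin[OF _ that] by (intro cSup_eq_maximum) auto
  moreover have "\<forall>\<^sub>F t in at_left T. t \<in> {0<..<T}"
    using pos by (intro eventually_at_leftI[of 0]) auto
  ultimately have "\<forall>\<^sub>F t in at_left T. (SUP x\<in>ball 0 R. u x t) = u 0 t"
    by (auto elim: eventually_mono)
  with assms show ?thesis
    unfolding touches_down_at_def by (blast intro: Lim_transform_eventually)
qed

lemma quenching_set:
  assumes td: "touches_down_at (ball 0 R) T u"
  shows "{x. quenching_point (ball 0 R) T u x} = {0}"
proof (intro equalityI subsetI)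
  obtain C where C: "C > 0"
    "\<And>x t. x \<in> ball 0 R \<Longrightarrow> t \<in> {3/4*T..<T} \<Longrightarrow> C * (norm x)\<^sup>2 \<le> u 0 t - u x t"
    using quadratic_separation by blast
  have q: "0 < 3/4*T" "3/4*T < T" using pos by auto
  obtain m where m: "m < 1" "\<And>x t. x \<in> cball 0 R \<Longrightarrow> t \<in> {0..3/4*T} \<Longrightarrow> u x t \<le> m"
    by (rule u_le_below_T[OF q], rule that)
  fix x assume "x \<in> {x. quenching_point (ball 0 R) T u x}"
  then obtain X \<tau> where X: "\<And>k. X k \<in> ball 0 R" "\<And>k. \<tau> k \<in> {0<..<T}" "X \<longlonglongrightarrow> x"
    "(\<lambda>k. u (X k) (\<tau> k)) \<longlonglongrightarrow> 1"
    unfolding quenching_point_def by blast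
  \<comment> \<open>Values close to 1 exceed the bound \<open>m\<close> valid up to
    \<open>3/4*T\<close>, so eventually the times lie in the range of the quadratic
    estimate.\<close>
  have "\<forall>\<^sub>F k in sequentially. C * (norm (X k))\<^sup>2 \<le> 1 - u (X k) (\<tau> k)"
    using order_tendstoD(1)[OF X(4) m(1)]
  proof eventually_elim
    case (elim k)
    have "\<tau> k > 3/4*T"
    proof (rule ccontr)
      assume "\<not> \<tau> k > 3/4*T"
      then have "u (X k) (\<tau> k) \<le> m" using X(1,2)[of k] by (intro m) auto
      with elim show False by simp
    qed
    then have "C * (norm (X k))\<^sup>2 \<le> u 0 (\<tau> k) - u (X k) (\<tau> k)"
      using X(1,2)[of k] by (intro C) auto
    moreover have "u 0 (\<tau> k) < 1" using X(2)[of k] pos by (intro u_bounds) auto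
    ultimately show ?case by simp
  qed
  moreover have "(\<lambda>k. C * (norm (X k))\<^sup>2) \<longlonglongrightarrow> C * (norm x)\<^sup>2"
    by (intro tendsto_intros X)
  moreover have "(\<lambda>k. 1 - u (X k) (\<tau> k)) \<longlonglongrightarrow> 1 - 1"
    by (intro tendsto_intros X)
  ultimately have "C * (norm x)\<^sup>2 \<le> 1 - 1"
    by (intro tendsto_le[OF sequentially_bot, of "\<lambda>k. 1 - u (X k) (\<tau> k)" _ "\<lambda>k. C * (norm (X k))\<^sup>2"])
  with C(1) show "x \<in> {0}" by (simp add: mult_le_0_iff)
next
  fix x :: "real ^ 'n" assume "x \<in> {0}"
  \<comment> \<open>Times for a sequence resting at the origin; \<open>k + 2\<close> keeps
    \<open>\<tau> 0\<close> positive.\<close>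
  define \<tau> where "\<tau> k = T - T / real (k + 2)" for k
  have \<tau>: "\<tau> k \<in> {0<..<T}" for k
  proof -
    have "T / real (k + 2) < T / 1"
      using pos by (intro divide_strict_left_mono) auto
    then show ?thesis using pos by (auto simp: \<tau>_def)
  qed
  have "(\<lambda>k. T / real (k + 2)) \<longlonglongrightarrow> 0"
    using LIMSEQ_ignore_initial_segment[OF lim_const_over_n[of T], of 2] by simp
  then have "\<tau> \<longlonglongrightarrow> T - 0"
    unfolding \<tau>_def by (intro tendsto_intros)
  then have "filterlim \<tau> (at_left T) sequentially"
    using \<tau> by (auto simp: filterlim_at intro!: always_eventually)
  from filterlim_compose[OF origin_limit[OF td] this]
  have "(\<lambda>k. u 0 (\<tau> k)) \<longlonglongrightarrow> 1" .
  with \<tau> pos \<open>x \<in> {0}\<close> show "x \<in> {x. quenching_point (ball 0 R) T u x}"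
    unfolding quenching_point_def by (auto intro!: exI[of _ "\<lambda>_. 0"] exI[of _ \<tau>])
qed

end

subsection \<open>Integrability and conclusion\<close>

text \<open>At \<open>z = 0\<close> the integrand is \<open>1 / 0 = 0\<close>; elsewhere it is dominated on dyadic balls.\<close>

lemma inverse_square_integrable_ball:
  fixes R :: real
  assumes R: "R > 0" and n: "CARD('n::finite) \<ge> 3"
  shows "(\<integral>\<^sup>+z\<in>ball (0::real ^ 'n) R. ennreal (1 / (norm z)\<^sup>2) \<partial>lebesgue) < \<infinity>"
proof -
  let ?B = "\<lambda>j. ball (0::real ^ 'n) (R / 2 ^ j)"
  define V where "V = unit_ball_vol (real CARD('n))"
  have V: "V \<ge> 0" by (simp add: V_def)
  have le_suminf: "g j \<le> (\<Sum>j. g j)" for g :: "nat \<Rightarrow> ennreal" and j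
    using sum_le_suminf[of g "{j}"] by simp
  have "(\<integral>\<^sup>+z\<in>ball (0::real ^ 'n) R. ennreal (1 / (norm z)\<^sup>2) \<partial>lebesgue)
      \<le> (\<integral>\<^sup>+z. (\<Sum>j. ennreal (4 ^ Suc j / R\<^sup>2) * indicator (?B j) z) \<partial>lebesgue)"
  proof (rule nn_integral_mono)
    fix z :: "real ^ 'n"
    let ?f = "\<lambda>j. ennreal (4 ^ Suc j / R\<^sup>2) * indicator (?B j) z"
    show "ennreal (1 / (norm z)\<^sup>2) * indicator (ball 0 R) z \<le> (\<Sum>j. ?f j)"
    proof (cases "z \<in> ball 0 R \<and> z \<noteq> 0")
      case True
      then have nz: "norm z > 0" "norm z < R" by auto
      obtain N where "(1 / 2) ^ N < norm z / R"
        using real_arch_pow_inv[of "norm z / R" "1/2"] nz R by auto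
      then have "R / 2 ^ N \<le> norm z"
        using R by (simp add: field_simps)
      \<comment> \<open>Locates the dyadic shell of \<open>z\<close>: \<open>Suc j\<close> is the
        first index whose radius is at most \<open>norm z\<close>.\<close>
      with nz obtain j where j: "\<not> R / 2 ^ j \<le> norm z" "R / 2 ^ Suc j \<le> norm z"
        using ex_least_nat_less[of "\<lambda>j. R / 2 ^ j \<le> norm z" N] by auto
      have "(R / 2 ^ Suc j)\<^sup>2 \<le> (norm z)\<^sup>2"
        using j(2) R by (intro power_mono) auto
      moreover have "0 < (norm z)\<^sup>2 * (R / 2 ^ Suc j)\<^sup>2"
        using nz(1) by (intro mult_pos_pos zero_less_power divide_pos_pos R) auto
      ultimately have "1 / (norm z)\<^sup>2 \<le> 1 / (R / 2 ^ Suc j)\<^sup>2"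
        by (intro divide_left_mono) auto
      also have "\<dots> = 4 ^ Suc j / R\<^sup>2"
      proof -
        have "(2 ^ Suc j)\<^sup>2 = ((2::real)\<^sup>2) ^ Suc j"
          by (metis power_mult mult.commute)
        then show ?thesis by (simp add: power_divide)
      qed
      finally have "ennreal (1 / (norm z)\<^sup>2) \<le> ?f j"
        using j(1) by (auto simp: indicator_def intro!: ennreal_leI)
      also have "\<dots> \<le> (\<Sum>j. ?f j)"
        by (rule le_suminf)
      finally show ?thesis using True by (simp add: indicator_def)
    qed (auto simp: indicator_def)
  qed
  also have "\<dots> = (\<Sum>j. ennreal (4 ^ Suc j / R\<^sup>2) * emeasure lebesgue (?B j))"
    by (subst nn_integral_suminf)
       (auto simp: nn_integral_cmult_indicator
         intro!: borel_measurable_times_ennreal borel_measurable_indicator)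
  \<comment> \<open>In dimension \<open>n\<close> the \<open>j\<close>-th ball contributes a
    constant times \<open>(4 / 2 ^ n) ^ j\<close>; the ratio is at most \<open>1 / 2\<close> once
    \<open>n \<ge> 3\<close>.\<close>
  also have "\<dots> \<le> (\<Sum>j. ennreal (4 * V * R ^ CARD('n) / R\<^sup>2 * (1 / 2) ^ j))"
  proof (rule suminf_le)
    fix j
    have "emeasure lebesgue (?B j) = ennreal (V * (R / 2 ^ j) ^ CARD('n))"
      using R by (simp add: emeasure_completion emeasure_ball V_def)
    then have "ennreal (4 ^ Suc j / R\<^sup>2) * emeasure lebesgue (?B j)
        = ennreal (4 ^ Suc j / R\<^sup>2 * (V * (R / 2 ^ j) ^ CARD('n)))"
      using R V by (subst ennreal_mult) auto
    also have "4 ^ Suc j / R\<^sup>2 * (V * (R / 2 ^ j) ^ CARD('n))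
        = 4 * V * R ^ CARD('n) / R\<^sup>2 * (4 ^ j / (2 ^ j) ^ CARD('n))"
      by (simp add: power_divide)
    also have "\<dots> \<le> 4 * V * R ^ CARD('n) / R\<^sup>2 * (1 / 2) ^ j"
    proof (rule mult_left_mono)
      have "(2 ^ 3) ^ j = ((2::real) ^ j) ^ 3"
        by (metis power_mult mult.commute)
      then have "(8::real) ^ j = (2 ^ j) ^ 3" by simp
      also have "\<dots> \<le> (2 ^ j) ^ CARD('n)" using n by (intro power_increasing) auto
      finally have "(4::real) ^ j / (2 ^ j) ^ CARD('n) \<le> 4 ^ j / 8 ^ j"
        by (intro divide_left_mono) auto
      also have "\<dots> = (1 / 2) ^ j" by (simp add: power_divide[symmetric])
      finally show "(4::real) ^ j / (2 ^ j) ^ CARD('n) \<le> (1 / 2) ^ j" .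
    qed (use V R in auto)
    finally show "ennreal (4 ^ Suc j / R\<^sup>2) * emeasure lebesgue (?B j)
        \<le> ennreal (4 * V * R ^ CARD('n) / R\<^sup>2 * (1 / 2) ^ j)"
      by (simp add: ennreal_leI)
  qed auto
  also have "\<dots> < \<infinity>"
  proof -
    have "(\<Sum>j. ennreal (4 * V * R ^ CARD('n) / R\<^sup>2 * (1 / 2) ^ j)) \<noteq> top"
      using V R by (intro ennreal_suminf_neq_top summable_mult summable_geometric) auto
    then show ?thesis by (simp add: top.not_eq_extremum)
  qed
  finally show ?thesis .
qed

text \<open>Up to \<open>3/4*T\<close>, including \<open>t = 0\<close>, the integrand is at most
  \<open>1 / (1 - m)\<close>; afterwards the quadratic separation bounds it by
  \<open>1 / (C * (norm z)\<^sup>2)\<close>, integrable in dimension at least 3.\<close>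

lemma (in radial_solution) nonlocal_term_bounded:
  assumes n: "CARD('n) \<ge> 3"
  shows "(SUP t\<in>{0..<T}. \<integral>\<^sup>+z\<in>ball 0 R. ennreal (1 / (1 - u z t)) \<partial>lebesgue) < \<infinity>"
proof -
  obtain C where C: "C > 0"
    "\<And>x t. x \<in> ball 0 R \<Longrightarrow> t \<in> {3/4*T..<T} \<Longrightarrow> C * (norm x)\<^sup>2 \<le> u 0 t - u x t"
    using quadratic_separation by blast
  have q: "0 < 3/4*T" "3/4*T < T" using pos by auto
  obtain m where m: "m < 1" "\<And>x t. x \<in> cball 0 R \<Longrightarrow> t \<in> {0..3/4*T} \<Longrightarrow> u x t \<le> m"
    by (rule u_le_below_T[OF q], rule that)
  let ?A = "ennreal (1 / (1 - m)) * emeasure lebesgue (ball (0::real ^ 'n) R)"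
  let ?B = "ennreal (1 / C) * (\<integral>\<^sup>+z\<in>ball (0::real ^ 'n) R. ennreal (1 / (norm z)\<^sup>2) \<partial>lebesgue)"
  have "(\<integral>\<^sup>+z\<in>ball 0 R. ennreal (1 / (1 - u z t)) \<partial>lebesgue) \<le> ?A + ?B" if t: "t \<in> {0..<T}" for t
  proof (cases "t \<le> 3/4*T")
    case True
    have "(\<integral>\<^sup>+z\<in>ball 0 R. ennreal (1 / (1 - u z t)) \<partial>lebesgue)
        \<le> (\<integral>\<^sup>+z. ennreal (1 / (1 - m)) * indicator (ball (0::real ^ 'n) R) z \<partial>lebesgue)"
    proof (rule nn_integral_mono)
      fix z :: "real ^ 'n"
      show "ennreal (1 / (1 - u z t)) * indicator (ball 0 R) z
          \<le> ennreal (1 / (1 - m)) * indicator (ball 0 R) z"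
        using m(1) m(2)[of z t] True t
        by (auto simp: indicator_def intro!: ennreal_leI divide_left_mono)
    qed
    also have "\<dots> = ?A" by (simp add: nn_integral_cmult_indicator)
    finally show ?thesis by (rule order_trans) simp
  next
    case False
    \<comment> \<open>The origin is removed as a null set: the quadratic bound is void there, and
      the majorant takes the default value \<open>1 / 0 = 0\<close>.\<close>
    have "AE z in lebesgue. z \<noteq> (0::real ^ 'n)"
      by (rule AE_completion) (use AE_lborel_singleton in auto)
    then have "(\<integral>\<^sup>+z\<in>ball 0 R. ennreal (1 / (1 - u z t)) \<partial>lebesgue)
        \<le> (\<integral>\<^sup>+z. ennreal (1 / C) * (ennreal (1 / (norm z)\<^sup>2) * indicator (ball (0::real ^ 'n) R) z) \<partial>lebesgue)"
    proof (intro nn_integral_mono_AE, eventually_elim)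
      case (elim z)
      show ?case
      proof (cases "z \<in> ball 0 R")
        case True
        have "C * (norm z)\<^sup>2 \<le> u 0 t - u z t" "u 0 t < 1"
          using C(2)[OF True] u_bounds(2)[of 0 t] t False pos by auto
        then have le: "C * (norm z)\<^sup>2 \<le> 1 - u z t" by simp
        moreover have Cz: "0 < C * (norm z)\<^sup>2" using C(1) elim by simp
        ultimately have "0 < 1 - u z t" by linarith
        then have "1 / (1 - u z t) \<le> 1 / (C * (norm z)\<^sup>2)"
          using Cz by (intro divide_left_mono[OF le]) (simp_all only: mult_pos_pos zero_le_one)
        then have "ennreal (1 / (1 - u z t)) \<le> ennreal (1 / C * (1 / (norm z)\<^sup>2))"
          by (intro ennreal_leI) simp
        also have "\<dots> = ennreal (1 / C) * ennreal (1 / (norm z)\<^sup>2)"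
          using C(1) by (intro ennreal_mult) auto
        finally show ?thesis using True by simp
      qed simp
    qed
    also have "\<dots> = ?B"
      by (rule nn_integral_cmult[OF measurable_completion], measurable) (simp add: pred_def)
    finally show ?thesis by (rule order_trans) simp
  qed
  then have "(SUP t\<in>{0..<T}. \<integral>\<^sup>+z\<in>ball 0 R. ennreal (1 / (1 - u z t)) \<partial>lebesgue) \<le> ?A + ?B"
    by (rule SUP_least)
  also have "\<dots> < \<infinity>"
    using inverse_square_integrable_ball[OF pos(3) n]
    by (simp add: ennreal_mult_less_top emeasure_completion emeasure_lborel_ball_finite[simplified])
  finally show ?thesis .
qed

theorem theorem0p8:
  fixes lam chi R a T :: real
    and u0 :: "real ^ 'n::finite \<Rightarrow> real"
    and \<phi> :: "real \<Rightarrow> real"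
    and u :: "real ^ 'n \<Rightarrow> real \<Rightarrow> real"
  assumes "lam > 0" and "chi > 0" and "R > 0" and "0 < a" and "a < 1" and "T > 0"
    and u0_bounds: "\<And>x. x \<in> ball 0 R \<Longrightarrow> 0 \<le> u0 x \<and> u0 x \<le> a"
    and u0_radial: "\<And>x. x \<in> ball 0 R \<Longrightarrow> u0 x = \<phi> (norm x)"
    and u0_decreasing: "antimono_on {0..R} \<phi>"
    and solution: "nonlocal_solution lam chi (ball 0 R) T u0 u"
    and u_bounds: "\<And>x t. x \<in> ball 0 R \<Longrightarrow> t \<in> {0<..<T} \<Longrightarrow> 0 \<le> u x t \<and> u x t < 1"
    and touchdown: "touches_down_at (ball 0 R) T u"
  shows "(\<exists>t\<^sub>0\<in>{0<..<T}. \<exists>C>0. \<forall>x\<in>ball 0 R. \<forall>t\<in>{t\<^sub>0..<T}. 1 - u x t \<ge> C * (norm x)\<^sup>2)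
    \<and> {x. quenching_point (ball 0 R) T u x} = {0}
    \<and> (CARD('n) \<ge> 3 \<longrightarrow>
         (SUP t\<in>{0..<T}. \<integral>\<^sup>+z\<in>ball 0 R. ennreal (1 / (1 - u z t)) \<partial>lebesgue) < \<infinity>)"
proof -
  interpret radial_solution lam chi R T u0 \<phi> u
    using assms by unfold_locales auto
  obtain C where C: "C > 0"
    "\<And>x t. x \<in> ball 0 R \<Longrightarrow> t \<in> {3/4*T..<T} \<Longrightarrow> C * (norm x)\<^sup>2 \<le> u 0 t - u x t"
    using quadratic_separation by blast
  have "C * (norm x)\<^sup>2 \<le> 1 - u x t" if "x \<in> ball 0 R" "t \<in> {3/4*T..<T}" for x t
  proof -
    have "u 0 t < 1" using u_bounds[of 0 t] that(2) assms by auto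
    with C(2)[OF that] show ?thesis by linarith
  qed
  moreover have "3/4*T \<in> {0<..<T}" using assms by auto
  ultimately show ?thesis
    using C(1) quenching_set[OF touchdown] nonlocal_term_bounded by blast
qed

end
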